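(* Let $B$ be a separable Banach space, $K\subseteq B$ a proper convex cone whose dual cone generates $B^*$, and $p\in\mathbb N$, $q\in\mathbb N_0$ with $q<p$. Let $(Y_t)_{t\ge0}$ be a CARMA$(p,q)$ process (see context) with operators $\mathcal A_p,\mathcal E_p,\mathcal C_q$ and initial state $\mathbf X_0=\mathbf x\in K^p$, driven by a pure-jump $K$-valued Lévy process with triplet $(\gamma,0,\ell)$, and set $\gamma_0=\gamma-I_\ell$. Assume $$\int_{\{z\in K:\|z\|>1\}}|\langle g,z\rangle|\,\ell(\mathrm dz)<\infty\qquad\text{for all } g\in B^*.$$ Let $g\in B^*$ and let $(\mathcal S_t^* )_{t\ge0}$ be the adjoint semigroup generated by $\mathcal A_p^*$. Then for all $t\ge0$, $$\mathbb E[\langle g,Y_t\rangle]=\langle\mathcal S_t^*\mathcal C_q^*g,\mathbf x\rangle_p+\int_0^t\Big(\langle\mathcal E_p^*\mathcal S_{t-s}^*\mathcal C_q^*g,\gamma_0\rangle+\int_K\langle\mathcal E_p^*\mathcal S_{t-s}^*\mathcal C_q^*g,z\rangle\,\ell(\mathrm dz)\Big)\mathrm ds .$$ Moreover, if $$\int_{\{z\in K:\|z\|>1\}}|\langle g,z\rangle|^2\,\ell(\mathrm dz)<\infty\qquad\text{for all } g\in B^*,$$ then $$\mathrm{Var}[\langle g,Y_t\rangle]=\int_0^t\int_K\langle\mathcal E_p^*\mathcal S_{t-s}^*\mathcal C_q^*g,z\rangle^2\,\ell(\mathrm dz)\,\mathrm ds .$$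
   Context: A convex cone is a nonempty closed convex set $K$ with $\lambda K\subseteq K$ for $\lambda\ge0$; generating if $B=K-K$; a generating cone is proper if $x,-x\in K$ imply $x=0$. $K^*=\{f\in B^*:\langle f,x\rangle\ge0\ \forall x\in K\}$. $B^p$ carries the norm $\sum_i\|x^i\|$ and pairing $\langle\cdot,\cdot\rangle_p$. CARMA operators: $A_1,\dots,A_p$ and $\mathbb I$ are (possibly unbounded) densely defined linear operators on $B$ and $$\mathcal A_p=\begin{bmatrix}0&\mathbb I&0&\cdots&0\\ 0&0&\mathbb I&\ddots&\vdots\\ \vdots&\vdots&\ddots&\ddots&0\\ 0&\cdots&\cdots&0&\mathbb I\\ A_p&A_{p-1}&\cdots&\cdots&A_1\end{bmatrix}\colon D(\mathcal A_p)\subset B^p\to B^p;$$ $\mathcal E_p(x)=(0,\dots,0,\mathsf Ex)^\top$ with $\mathsf E\in\mathcal L(B)$; $\mathcal C_q(x^1,\dots,x^p)=\sum_{i=1}^{q+1}C_{i-1}x^i$ with $C_0,\dots,C_q\in\mathcal L(B)$. Standing assumptions for existence: $\mathcal A_p$ generates a strongly continuous semigroup $(\mathcal S_t)_{t\ge0}$ on $B^p$ with $\mathcal S_t(K^p)\subseteq K^p$ for all $t$, and $\mathsf E(K)\subseteq K$. The CARMA$(p,q)$ process is $Y_t=\mathcal C_q\mathbf X_t$, where $\mathbf X$ is the $K^p$-valued analytically weak solution of $\mathrm d\mathbf X_t=\mathcal A_p\mathbf X_t\,\mathrm dt+\mathcal E_p\,\mathrm dL_t$, $\mathbf X_0=\mathbf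 x$, given by $$\mathbf X_t=\mathcal S_t\mathbf x+\int_0^t\mathcal S_{t-s}\mathcal E_p\gamma\,\mathrm ds+\int_0^t\!\int_{0<\|z\|\le1}\mathcal S_{t-s}\mathcal E_pz\,\tilde N(\mathrm ds,\mathrm dz)+\int_0^t\!\int_{\|z\|>1}\mathcal S_{t-s}\mathcal E_pz\,N(\mathrm ds,\mathrm dz),$$ where $N$ is the Poisson random measure of jumps of $L$, $\tilde N(\mathrm ds,\mathrm dz)=N(\mathrm ds,\mathrm dz)-\ell(\mathrm dz)\,\mathrm ds$, and stochastic integrals are taken in the weak (Pettis) sense, i.e. tested against elements of $(B^p)^*$. Triplet $(\gamma,0,\ell)$ of $L$: $\mathbb E[e^{i\langle f,L_t\rangle}]=\exp\big(t(i\langle f,\gamma\rangle+\int_B(e^{i\langle f,z\rangle}-1-i\langle f,z\rangle\mathbf 1_{D_0}(z))\,\ell(\mathrm dz))\big)$, $D_0=\{0<\|x\|\le1\}$. Standing assumption: $\ell$ is concentrated on $K$ and there is $I_\ell\in B$ (the $\ell$-Pettis centering) with $\int_{D_0}|\langle f,z\rangle|\,\ell(\mathrm dz)<\infty$ and $\langle f,I_\ell\rangle=\int_{D_0}\langle f,z\rangle\,\ell(\mathrm dz)$ for all $f\in B^*$, and $\gamma-I_\ell\in K$. *)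

theory Defs
  imports "HOL-Probability.Probability"
begin

section \<open>Cones and adjoints\<close>

text \<open>
  The dual space of a Banach space \<open>'a\<close> is \<open>'a \<Rightarrow>\<^sub>L real\<close>; the pairing \<open>\<langle>f, x\<rangle>\<close> is application.
  The library predicate \<^const>\<open>convex_cone\<close> covers everything but closedness.
\<close>

definition proper_convex_cone :: "'a::real_normed_vector set \<Rightarrow> bool" where
  "proper_convex_cone K \<longleftrightarrow>
     closed K \<and> convex_cone K \<and>
     (\<forall>x. \<exists>y\<in>K. \<exists>z\<in>K. x = y - z) \<and>
     (\<forall>x. x \<in> K \<and> - x \<in> K \<longrightarrow> x = 0)"

definition dual_cone :: "'a::real_normed_vector set \<Rightarrow> ('a \<Rightarrow>\<^sub>L real) set" where
  "dual_cone K = {f :: 'a \<Rightarrow>\<^sub>L real. \<forall>x\<in>K. 0 \<le> f x}"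

definition dual_map ::
    "('a::real_normed_vector \<Rightarrow>\<^sub>L 'b::real_normed_vector) \<Rightarrow> ('b \<Rightarrow>\<^sub>L real) \<Rightarrow> ('a \<Rightarrow>\<^sub>L real)" where
  "dual_map T f = f o\<^sub>L T"

section \<open>Unbounded operators and semigroups\<close>

definition linear_operator ::
    "'a::real_normed_vector set \<Rightarrow> ('a \<Rightarrow> 'b::real_normed_vector) \<Rightarrow> bool" where
  "linear_operator D T \<longleftrightarrow> subspace D \<and>
     (\<forall>x\<in>D. \<forall>y\<in>D. T (x + y) = T x + T y) \<and> (\<forall>c. \<forall>x\<in>D. T (c *\<^sub>R x) = c *\<^sub>R T x)"

definition densely_defined_operator ::
    "'a::real_normed_vector set \<Rightarrow> ('a \<Rightarrow> 'b::real_normed_vector) \<Rightarrow> bool" where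
  "densely_defined_operator D T \<longleftrightarrow> linear_operator D T \<and> closure D = UNIV"

definition strongly_continuous_semigroup ::
    "(real \<Rightarrow> 'b::real_normed_vector \<Rightarrow>\<^sub>L 'b) \<Rightarrow> bool" where
  "strongly_continuous_semigroup S \<longleftrightarrow>
     S 0 = id_blinfun \<and>
     (\<forall>s\<ge>0. \<forall>t\<ge>0. S (s + t) = S s o\<^sub>L S t) \<and>
     (\<forall>x. continuous_on {0..} (\<lambda>t. S t x))"

text \<open>The operator \<open>T\<close> with domain exactly \<open>D\<close> is the infinitesimal generator of \<open>S\<close>.\<close>

definition generates ::
    "'b::real_normed_vector set \<Rightarrow> ('b \<Rightarrow> 'b) \<Rightarrow> (real \<Rightarrow> 'b \<Rightarrow>\<^sub>L 'b) \<Rightarrow> bool" where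
  "generates D T S \<longleftrightarrow> strongly_continuous_semigroup S \<and>
     (\<forall>x y. ((\<lambda>h. (S h x - x) /\<^sub>R h) \<longlongrightarrow> y) (at_right 0) \<longleftrightarrow> x \<in> D \<and> T x = y)"

section \<open>The CARMA operators\<close>

text \<open>
  The space \<open>B\<^sup>p\<close> is \<open>'a ^ 'p\<close> with \<open>p = CARD('p)\<close>, where \<open>'p\<close> is a finite linearly ordered index type.
  Indices are numbered \<open>1, ..., p\<close> in increasing order; \<open>coord x k\<close> is the component \<open>x\<^sup>k\<close> and is
  only meaningful for \<open>1 \<le> k \<le> p\<close>. The library norm on \<open>'a ^ 'p\<close> is the Euclidean combination of the
  component norms, which is equivalent to their sum; every notion below depends on the
  topology of \<open>B\<^sup>p\<close> only.
\<close>

definition pos :: "'p::{finite,linorder} \<Rightarrow> nat" where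
  "pos i = card {..i}"

definition coord :: "('a ^ 'p::{finite,linorder}) \<Rightarrow> nat \<Rightarrow> 'a" where
  "coord x k = x $ (THE i. pos i = k)"

definition cone_power :: "'a set \<Rightarrow> ('a ^ 'p::{finite,linorder}) set" where
  "cone_power K = {x. \<forall>i. x $ i \<in> K}"

definition carma_matrix ::
    "('a::real_normed_vector \<Rightarrow> 'a) \<Rightarrow> (nat \<Rightarrow> 'a \<Rightarrow> 'a) \<Rightarrow> ('a ^ 'p::{finite,linorder}) \<Rightarrow> ('a ^ 'p::{finite,linorder})" where
  "carma_matrix I A x =
     (\<chi> i. if pos i < CARD('p) then I (coord x (pos i + 1))
          else \<Sum>k = 1..CARD('p). A (CARD('p) + 1 - k) (coord x k))"

text \<open>The largest domain on which all entries of the operator matrix can be applied.\<close>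

definition carma_max_domain ::
    "'a set \<Rightarrow> (nat \<Rightarrow> 'a set) \<Rightarrow> ('a ^ 'p::{finite,linorder}) set" where
  "carma_max_domain DI DA =
     {x. (\<forall>k\<in>{2..CARD('p)}. coord x k \<in> DI) \<and>
         (\<forall>k\<in>{1..CARD('p)}. coord x k \<in> DA (CARD('p) + 1 - k))}"

lift_definition carma_E ::
    "('a::real_normed_vector \<Rightarrow>\<^sub>L 'a) \<Rightarrow> 'a \<Rightarrow>\<^sub>L ('a ^ 'p::{finite,linorder})" is
  "\<lambda>E x. (\<chi> i. if pos i = CARD('p) then E x else 0)"
proof -
  fix E :: "'a::real_normed_vector \<Rightarrow> 'a" assume E: "bounded_linear E"
  interpret bounded_linear E by (rule E)
  have "bounded_linear (\<lambda>x. axis i (if pos i = CARD('p) then E x else 0) :: ('a, 'p) vec)" for i :: 'p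
  proof (cases "pos i = CARD('p)")
    case True
    have "bounded_linear (\<lambda>x. axis i (E x) :: ('a, 'p) vec)"
    proof (rule bounded_linear_intro[where K = "onorm E"])
      fix x y and r :: real
      show "(axis i (E (x + y)) :: ('a, 'p) vec) = axis i (E x) + axis i (E y)"
        by (simp add: vec_eq_iff axis_def add)
      show "(axis i (E (r *\<^sub>R x)) :: ('a, 'p) vec) = r *\<^sub>R axis i (E x)"
        by (simp add: vec_eq_iff axis_def scaleR)
      have "norm (axis i (E x) :: ('a, 'p) vec) \<le> (\<Sum>j\<in>UNIV. norm ((axis i (E x) :: ('a, 'p) vec) $ j))"
        unfolding norm_vec_def by (rule L2_set_le_sum) simp
      also have "\<dots> = (\<Sum>j\<in>UNIV. if i = j then norm (E x) else 0)"
        by (rule sum.cong) (auto simp: axis_def)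
      also have "\<dots> \<le> norm x * onorm E"
        using onorm[OF E, of x] by (simp add: mult.commute)
      finally show "norm (axis i (E x) :: ('a, 'p) vec) \<le> norm x * onorm E" .
    qed
    with True show ?thesis by simp
  next
    case False
    have *: "axis i (0 :: 'a) = (0 :: ('a, 'p) vec)" by (simp add: vec_eq_iff axis_def)
    from False show ?thesis by (simp add: * bounded_linear_zero)
  qed
  then have "bounded_linear (\<lambda>x. \<Sum>i\<in>UNIV. axis i (if pos i = CARD('p) then E x else 0) :: ('a, 'p) vec)"
    by (rule bounded_linear_sum)
  moreover have "(\<Sum>i\<in>UNIV. axis i (if pos i = CARD('p) then E x else 0) :: ('a, 'p) vec) =
      (\<chi> i. if pos i = CARD('p) then E x else 0)" for x
    by (simp add: vec_eq_iff axis_def)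
  ultimately show "bounded_linear (\<lambda>x. (\<chi> i. if pos i = CARD('p) then E x else 0) :: ('a, 'p) vec)"
    by simp
qed

lift_definition carma_C ::
    "nat \<Rightarrow> (nat \<Rightarrow> 'a::real_normed_vector \<Rightarrow>\<^sub>L 'a) \<Rightarrow> ('a ^ 'p::{finite,linorder}) \<Rightarrow>\<^sub>L 'a" is
  "\<lambda>q C x. \<Sum>i = 1..q + 1. C (i - 1) (coord x i)"
  unfolding coord_def
  by (intro bounded_linear_sum bounded_linear_compose[OF _ bounded_linear_vec_nth])

section \<open>Levy processes and their jumps\<close>

text \<open>Processes are indexed by \<^typ>\<open>real\<close>; only times \<open>t \<ge> 0\<close> matter.\<close>

definition cadlag :: "(real \<Rightarrow> 'a::topological_space) \<Rightarrow> bool" where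
  "cadlag f \<longleftrightarrow>
     (\<forall>t\<ge>0. (f \<longlongrightarrow> f t) (at_right t)) \<and> (\<forall>t>0. \<exists>l. (f \<longlongrightarrow> l) (at_left t))"

definition levy_process :: "'w measure \<Rightarrow> (real \<Rightarrow> 'w \<Rightarrow> 'a::real_normed_vector) \<Rightarrow> bool" where
  "levy_process M L \<longleftrightarrow>
     (\<forall>t\<ge>0. L t \<in> borel_measurable M) \<and>
     (AE \<omega> in M. L 0 \<omega> = 0) \<and>
     (\<forall>\<omega>\<in>space M. cadlag (\<lambda>t. L t \<omega>)) \<and>
     (\<forall>\<tau> n. 0 \<le> \<tau> 0 \<and> mono \<tau> \<longrightarrow>
        prob_space.indep_vars M (\<lambda>_. borel) (\<lambda>k \<omega>. L (\<tau> (Suc k)) \<omega> - L (\<tau> k) \<omega>) {..<n::nat}) \<and>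
     (\<forall>s\<ge>0. \<forall>t\<ge>0. distr M borel (\<lambda>\<omega>. L (s + t) \<omega> - L s \<omega>) = distr M borel (L t))"

definition jump :: "(real \<Rightarrow> 'w \<Rightarrow> 'a::real_normed_vector) \<Rightarrow> real \<Rightarrow> 'w \<Rightarrow> 'a" where
  "jump L t \<omega> = L t \<omega> - Lim (at_left t) (\<lambda>s. L s \<omega>)"

text \<open>
  The random measure \<open>N\<close>: the image of counting measure on the set of jump times under
  \<open>t \<mapsto> (t, \<Delta>L\<^sub>t)\<close>.
\<close>

definition jump_measure ::
    "(real \<Rightarrow> 'w \<Rightarrow> 'a::real_normed_vector) \<Rightarrow> 'w \<Rightarrow> (real \<times> 'a) measure" where
  "jump_measure L \<omega> =
     distr (count_space {t. 0 < t \<and> jump L t \<omega> \<noteq> 0}) (borel \<Otimes>\<^sub>M borel) (\<lambda>t. (t, jump L t \<omega>))"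

definition poisson_random_measure ::
    "'w measure \<Rightarrow> ('w \<Rightarrow> 'b measure) \<Rightarrow> 'b measure \<Rightarrow> bool" where
  "poisson_random_measure M N \<mu> \<longleftrightarrow>
     (\<forall>\<omega>\<in>space M. sets (N \<omega>) = sets \<mu>) \<and>
     (\<forall>A\<in>sets \<mu>. (\<lambda>\<omega>. emeasure (N \<omega>) A) \<in> borel_measurable M) \<and>
     (\<forall>A\<in>sets \<mu>. emeasure \<mu> A < \<infinity> \<longrightarrow>
        (\<forall>k::nat. measure M {\<omega> \<in> space M. emeasure (N \<omega>) A = of_nat k} =
           exp (- measure \<mu> A) * measure \<mu> A ^ k / fact k)) \<and>
     (\<forall>A\<in>sets \<mu>. emeasure \<mu> A = \<infinity> \<longrightarrow> (AE \<omega> in M. emeasure (N \<omega>) A = \<infinity>)) \<and>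
     (\<forall>(A :: nat \<Rightarrow> 'b set) n. range A \<subseteq> sets \<mu> \<and> disjoint_family_on A {..<n} \<longrightarrow>
        prob_space.indep_vars M (\<lambda>_. borel) (\<lambda>k \<omega>. emeasure (N \<omega>) (A k)) {..<n})"

text \<open>The intensity \<open>ds \<ell>(dz)\<close> on \<open>(0, \<infinity>) \<times> B\<close>, extended by zero to times \<open>s \<le> 0\<close>.\<close>

definition jump_intensity :: "'a::real_normed_vector measure \<Rightarrow> (real \<times> 'a) measure" where
  "jump_intensity l = density lborel (indicator {0<..}) \<Otimes>\<^sub>M l"

definition levy_measure :: "'a::real_normed_vector measure \<Rightarrow> bool" where
  "levy_measure l \<longleftrightarrow>
     sets l = sets borel \<and> emeasure l {0} = 0 \<and>
     (\<forall>r>0. emeasure l {z. r < norm z} < \<infinity>) \<and>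
     (\<forall>f :: 'a \<Rightarrow>\<^sub>L real.
        (\<integral>\<^sup>+z\<in>{z. 0 < norm z \<and> norm z \<le> 1}. ennreal ((f z)\<^sup>2) \<partial>l) < \<infinity>)"

text \<open>The law of \<open>L\<close> has characteristic triplet \<open>(\<gamma>, 0, \<ell>)\<close>.\<close>

definition pure_jump_triplet ::
    "'w measure \<Rightarrow> (real \<Rightarrow> 'w \<Rightarrow> 'a::real_normed_vector) \<Rightarrow> 'a \<Rightarrow> 'a measure \<Rightarrow> bool" where
  "pure_jump_triplet M L \<gamma> l \<longleftrightarrow> levy_measure l \<and>
     (\<forall>t\<ge>0. \<forall>f :: 'a \<Rightarrow>\<^sub>L real.
        (LINT \<omega>|M. iexp (f (L t \<omega>))) =
        exp (complex_of_real t * (\<i> * complex_of_real (f \<gamma>) +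
          (LINT z|l. iexp (f z) - 1 -
             \<i> * complex_of_real (f z * indicator {z. 0 < norm z \<and> norm z \<le> 1} z)))))"

definition pettis_centering :: "'a::real_normed_vector measure \<Rightarrow> 'a \<Rightarrow> bool" where
  "pettis_centering l c \<longleftrightarrow>
     (\<forall>f :: 'a \<Rightarrow>\<^sub>L real.
        (\<integral>\<^sup>+z\<in>{z. 0 < norm z \<and> norm z \<le> 1}. ennreal \<bar>f z\<bar> \<partial>l) < \<infinity> \<and>
        f c = (LINT z:{z. 0 < norm z \<and> norm z \<le> 1}|l. f z))"

section \<open>Stochastic integrals\<close>

text \<open>
  The scalar integral of a deterministic integrand over \<open>(0, t] \<times> {0 < \<parallel>z\<parallel> \<le> 1}\<close> against the
  compensated measure \<open>N - \<mu>\<close>: the \<open>L\<^sup>2\<close>-limit of the integrals over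
  \<open>(0, t] \<times> {\<epsilon> < \<parallel>z\<parallel> \<le> 1}\<close> as \<open>\<epsilon>\<close> decreases to 0.
\<close>

definition has_compensated_integral ::
    "'w measure \<Rightarrow> ('w \<Rightarrow> (real \<times> 'a::real_normed_vector) measure) \<Rightarrow> (real \<times> 'a) measure \<Rightarrow>
     real \<Rightarrow> (real \<times> 'a \<Rightarrow> real) \<Rightarrow> ('w \<Rightarrow> real) \<Rightarrow> bool" where
  "has_compensated_integral M N \<mu> t \<phi> J \<longleftrightarrow>
     J \<in> borel_measurable M \<and>
     ((\<lambda>\<epsilon>. \<integral>\<^sup>+\<omega>. ennreal ((J \<omega> -
          ((LINT u:{0<..t} \<times> {z. \<epsilon> < norm z \<and> norm z \<le> 1}|N \<omega>. \<phi> u) -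
           (LINT u:{0<..t} \<times> {z. \<epsilon> < norm z \<and> norm z \<le> 1}|\<mu>. \<phi> u)))\<^sup>2) \<partial>M)
        \<longlongrightarrow> 0) (at_right 0)"

text \<open>Weak (Pettis) versions for a vector-valued integrand \<open>F s z\<close>.\<close>

definition pettis_small_jump_integral ::
    "'w measure \<Rightarrow> ('w \<Rightarrow> (real \<times> 'a::real_normed_vector) measure) \<Rightarrow> (real \<times> 'a) measure \<Rightarrow>
     real \<Rightarrow> (real \<Rightarrow> 'a \<Rightarrow> 'b::real_normed_vector) \<Rightarrow> ('w \<Rightarrow> 'b) \<Rightarrow> bool" where
  "pettis_small_jump_integral M N \<mu> t F J \<longleftrightarrow>
     J \<in> borel_measurable M \<and>
     (\<forall>h :: 'b \<Rightarrow>\<^sub>L real.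
        has_compensated_integral M N \<mu> t (\<lambda>(s, z). h (F s z)) (\<lambda>\<omega>. h (J \<omega>)))"

definition pettis_large_jump_integral ::
    "'w measure \<Rightarrow> ('w \<Rightarrow> (real \<times> 'a::real_normed_vector) measure) \<Rightarrow>
     real \<Rightarrow> (real \<Rightarrow> 'a \<Rightarrow> 'b::real_normed_vector) \<Rightarrow> ('w \<Rightarrow> 'b) \<Rightarrow> bool" where
  "pettis_large_jump_integral M N t F J \<longleftrightarrow>
     J \<in> borel_measurable M \<and>
     (\<forall>h :: 'b \<Rightarrow>\<^sub>L real. AE \<omega> in M.
        h (J \<omega>) = (LINT u:{0<..t} \<times> {z. 1 < norm z}|N \<omega>. (case u of (s, z) \<Rightarrow> h (F s z))))"

section \<open>CARMA state process\<close>

text \<open>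
  Analytically weak solution of \<open>dX\<^sub>t = T X\<^sub>t dt + R dL\<^sub>t\<close>, \<open>X\<^sub>0 = x\<close>: tested against the graph of
  the adjoint of \<open>T\<close> (with domain \<open>D\<close>), i.e. against pairs \<open>(h, h')\<close> with \<open>T\<^sup>* h = h'\<close>.
\<close>

definition weak_solution ::
    "'w measure \<Rightarrow> 'b::real_normed_vector set \<Rightarrow> ('b \<Rightarrow> 'b) \<Rightarrow> ('a::real_normed_vector \<Rightarrow>\<^sub>L 'b) \<Rightarrow>
     (real \<Rightarrow> 'w \<Rightarrow> 'a) \<Rightarrow> 'b \<Rightarrow> (real \<Rightarrow> 'w \<Rightarrow> 'b) \<Rightarrow> bool" where
  "weak_solution M D T R L x X \<longleftrightarrow>
     (\<forall>h h' :: 'b \<Rightarrow>\<^sub>L real. (\<forall>y\<in>D. h (T y) = h' y) \<longrightarrow>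
        (\<forall>t\<ge>0. AE \<omega> in M.
           set_integrable lborel {0..t} (\<lambda>s. h' (X s \<omega>)) \<and>
           h (X t \<omega>) = h x + (LINT s:{0..t}|lborel. h' (X s \<omega>)) + h (R (L t \<omega>))))"

definition variation_of_constants ::
    "'w measure \<Rightarrow> (real \<Rightarrow> 'b::banach \<Rightarrow>\<^sub>L 'b) \<Rightarrow> ('a::real_normed_vector \<Rightarrow>\<^sub>L 'b) \<Rightarrow> 'a \<Rightarrow>
     ('w \<Rightarrow> (real \<times> 'a) measure) \<Rightarrow> (real \<times> 'a) measure \<Rightarrow> 'b \<Rightarrow> (real \<Rightarrow> 'w \<Rightarrow> 'b) \<Rightarrow> bool" where
  "variation_of_constants M S R \<gamma> N \<mu> x X \<longleftrightarrow>
     (\<forall>t\<ge>0. \<exists>J1 J2.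
        pettis_small_jump_integral M N \<mu> t (\<lambda>s z. S (t - s) (R z)) J1 \<and>
        pettis_large_jump_integral M N t (\<lambda>s z. S (t - s) (R z)) J2 \<and>
        (AE \<omega> in M. X t \<omega> =
           S t x + integral {0..t} (\<lambda>s. S (t - s) (R \<gamma>)) + J1 \<omega> + J2 \<omega>))"

end

theory Submission
  imports Defs
begin

text \<open>
  Write \<open>f\<^sub>s = \<E>\<^sub>p\<^sup>* S\<^sub>t\<^sub>-\<^sub>s\<^sup>* \<C>\<^sub>q\<^sup>* g\<close>. Finiteness of \<open>\<integral>|f| d\<ell>\<close> for every functional \<open>f\<close> makes this
  seminorm bounded on balls of the dual space (Baire), and \<open>S\<close> is bounded on \<open>[0, t]\<close> for the same
  reason; hence \<open>(s, z) \<mapsto> f\<^sub>s z\<close> is integrable for \<open>ds \<ell>(dz)\<close> on \<open>(0, t] \<times> B\<close>. The compensated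
  small jump integral therefore splits, the compensator cancels the part \<open>I\<^sub>l\<close> of the drift, and
  almost surely \<open>\<langle>g, Y\<^sub>t\<rangle>\<close> is a constant plus the absolutely convergent integral of \<open>f\<^sub>s z\<close> against
  the jump measure. Campbell's formulas give the mean and the variance of this integral; they
  follow from the Poisson moments by approximation with simple functions.
\<close>

section \<open>Moments of integrals against a Poisson random measure\<close>

text \<open>Only weak moments of \<open>l\<close> are finite: the integral of \<open>norm z\<close>
  may diverge, near 0 as well as for large jumps. Hence an estimate of the integrand by
  \<open>norm (f t s) * norm z\<close> cannot give integrability in (s, z), and finiteness for each
  single functional says nothing uniform in s. This is why a bound over a whole ball of the dual
  space is required. Square integrability near 0 belongs to every Levy measure; plain integrability
  there is what the Pettis centering adds, and it is what allows the compensator to be separated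
  from the jumps. A second obstacle is that the jump measure is described only through the masses of
  sets. Moments are therefore computed with values in [0, \<infinity>], where sums, products and
  monotone limits need no integrability conditions and sets of infinite intensity are harmless; real
  integrands enter afterwards through positive and negative parts.\<close>

lemma tendsto_power2_ennreal:
  fixes u :: "'a \<Rightarrow> ennreal"
  assumes "(u \<longlongrightarrow> l) F"
  shows "((\<lambda>n. (u n)\<^sup>2) \<longlongrightarrow> l\<^sup>2) F"
  \<comment> \<open>Equal factors rule out the pair 0 and \<infinity>, at which multiplication on
    \<open>ennreal\<close> is discontinuous.\<close>
  unfolding power2_eq_square using assms by (intro tendsto_mult_ennreal) auto

text \<open>The weights satisfy \<open>(k + 1) * p (k + 1) = m * p k\<close>, so each moment follows
  from the preceding ones by an index shift; the term at k = 0 lost in the shift is zero.\<close>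

lemma poisson_mass_sums:
  fixes m :: real
  shows "(\<lambda>k. exp (- m) * m ^ k / fact k) sums 1"
    and "(\<lambda>k. real k * (exp (- m) * m ^ k / fact k)) sums m"
    and "(\<lambda>k. (real k)\<^sup>2 * (exp (- m) * m ^ k / fact k)) sums (m + m\<^sup>2)"
proof -
  let ?p = "\<lambda>k. exp (- m) * m ^ k / fact k"
  have "(\<lambda>k. exp (- m) * (m ^ k /\<^sub>R fact k)) sums (exp (- m) * exp m)"
    by (intro sums_mult exp_converges)
  then show p: "?p sums 1"
    by (simp add: divide_simps exp_minus)
  have "(\<lambda>k. m * ?p k) sums (m * 1)"
    by (intro sums_mult p)
  moreover have "(\<lambda>k. real (Suc k) * ?p (Suc k)) = (\<lambda>k. m * ?p k)"
    by (simp add: divide_simps fun_eq_iff)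
  ultimately have "(\<lambda>k. real (Suc k) * ?p (Suc k)) sums m" by (simp only: mult_1_right)
  from sums_Suc[OF this] show kp: "(\<lambda>k. real k * ?p k) sums m" by simp
  have "(\<lambda>k. m * (real k * ?p k + ?p k)) sums (m * (m + 1))"
    by (intro sums_mult sums_add p kp)
  moreover have "(\<lambda>k. (real (Suc k))\<^sup>2 * ?p (Suc k)) = (\<lambda>k. m * (real k * ?p k + ?p k))"
    by (simp add: divide_simps power2_eq_square fun_eq_iff) (simp add: algebra_simps)
  ultimately have "(\<lambda>k. (real (Suc k))\<^sup>2 * ?p (Suc k)) sums (m * (m + 1))" by (simp only:)
  from sums_Suc[OF this] show "(\<lambda>k. (real k)\<^sup>2 * ?p k) sums (m + m\<^sup>2)"
    by (simp add: algebra_simps power2_eq_square)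
qed

text \<open>The masses at the natural numbers already sum to 1, so none is left for \<infinity> or
  for non-integral values.\<close>

lemma (in prob_space) poisson_distributed_AE_nat:
  fixes Z :: "'a \<Rightarrow> ennreal"
  assumes [measurable]: "Z \<in> borel_measurable M"
    and prob: "\<And>k::nat. prob {\<omega> \<in> space M. Z \<omega> = of_nat k} = exp (- m) * m ^ k / fact k"
  shows "AE \<omega> in M. \<exists>k. Z \<omega> = of_nat k"
proof -
  define A where "A k = {\<omega> \<in> space M. Z \<omega> = of_nat k}" for k :: nat
  have [measurable]: "A k \<in> events" for k by (simp add: A_def)
  have disj: "disjoint_family A"
    by (auto simp: disjoint_family_on_def A_def)
  have "(\<lambda>k. prob (A k)) sums prob (\<Union>k. A k)"
    by (rule finite_measure_UNION) (auto intro: disj)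
  moreover have "(\<lambda>k. prob (A k)) sums 1"
    using poisson_mass_sums(1)[of m] by (simp add: A_def prob)
  ultimately have "prob (\<Union>k. A k) = 1" by (rule sums_unique2)
  then have "AE \<omega> in M. \<omega> \<in> (\<Union>k. A k)" by (simp add: prob_eq_1)
  then show ?thesis by (auto simp: A_def)
qed

text \<open>Up to a null set \<open>h (Z \<omega>)\<close> is a countable sum of constants times
  indicators of the sets \<open>A k\<close>, so the integral is a series and \<open>h\<close> can be
  an arbitrary function.\<close>

lemma (in prob_space) nn_integral_poisson_distributed:
  fixes Z :: "'a \<Rightarrow> ennreal" and h :: "ennreal \<Rightarrow> ennreal"
  assumes [measurable]: "Z \<in> borel_measurable M"
    and prob: "\<And>k::nat. prob {\<omega> \<in> space M. Z \<omega> = of_nat k} = exp (- m) * m ^ k / fact k"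
  shows "(\<integral>\<^sup>+\<omega>. h (Z \<omega>) \<partial>M) = (\<Sum>k. h (of_nat k) * ennreal (exp (- m) * m ^ k / fact k))"
proof -
  define A where "A k = {\<omega> \<in> space M. Z \<omega> = of_nat k}" for k :: nat
  have [measurable]: "A k \<in> events" for k by (simp add: A_def)
  have "(\<integral>\<^sup>+\<omega>. h (Z \<omega>) \<partial>M) = (\<integral>\<^sup>+\<omega>. (\<Sum>k. h (of_nat k) * indicator (A k) \<omega>) \<partial>M)"
  proof (rule nn_integral_cong_AE)
    show "AE \<omega> in M. h (Z \<omega>) = (\<Sum>k. h (of_nat k) * indicator (A k) \<omega>)"
      using poisson_distributed_AE_nat[OF assms] AE_space
    proof eventually_elim
      case (elim \<omega>)
      then obtain k where k: "Z \<omega> = of_nat k" by auto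
      have "(\<Sum>j. h (of_nat j) * indicator (A j) \<omega>) = (\<Sum>j\<in>{k}. h (of_nat j) * indicator (A j) \<omega>)"
        by (rule suminf_finite) (auto simp: A_def k indicator_def)
      with elim k show ?case by (simp add: A_def)
    qed
  qed
  also have "\<dots> = (\<Sum>k. h (of_nat k) * emeasure M (A k))"
    by (simp add: nn_integral_suminf nn_integral_cmult)
  finally show ?thesis by (simp add: A_def emeasure_eq_measure prob)
qed

lemma (in prob_space) poisson_distributed_moments:
  fixes Z :: "'a \<Rightarrow> ennreal"
  assumes Z: "Z \<in> borel_measurable M"
    and prob: "\<And>k::nat. prob {\<omega> \<in> space M. Z \<omega> = of_nat k} = exp (- m) * m ^ k / fact k"
    and m: "0 \<le> m"
  shows "(\<integral>\<^sup>+\<omega>. Z \<omega> \<partial>M) = ennreal m"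
    and "(\<integral>\<^sup>+\<omega>. (Z \<omega>)\<^sup>2 \<partial>M) = ennreal m + (ennreal m)\<^sup>2"
proof -
  let ?p = "\<lambda>k. exp (- m) * m ^ k / fact k"
  have "(of_nat k :: ennreal) * ennreal (?p k) = ennreal (real k * ?p k)" for k
    by (subst ennreal_mult) (use m in \<open>auto simp: ennreal_of_nat_eq_real_of_nat\<close>)
  moreover have "(\<Sum>k. ennreal (real k * ?p k)) = ennreal m"
    using m by (intro suminf_ennreal_eq poisson_mass_sums) auto
  ultimately show "(\<integral>\<^sup>+\<omega>. Z \<omega> \<partial>M) = ennreal m"
    using nn_integral_poisson_distributed[OF Z prob, of "\<lambda>z. z"] by (simp only:)
  have "(of_nat k :: ennreal)\<^sup>2 * ennreal (?p k) = ennreal ((real k)\<^sup>2 * ?p k)" for k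
    by (subst ennreal_mult)
      (use m in \<open>auto simp: ennreal_of_nat_eq_real_of_nat ennreal_power\<close>)
  moreover have "(\<Sum>k. ennreal ((real k)\<^sup>2 * ?p k)) = ennreal (m + m\<^sup>2)"
    using m by (intro suminf_ennreal_eq poisson_mass_sums) auto
  moreover have "ennreal (m + m\<^sup>2) = ennreal m + (ennreal m)\<^sup>2"
    using m by (simp add: ennreal_power)
  ultimately show "(\<integral>\<^sup>+\<omega>. (Z \<omega>)\<^sup>2 \<partial>M) = ennreal m + (ennreal m)\<^sup>2"
    using nn_integral_poisson_distributed[OF Z prob, of "\<lambda>z. z\<^sup>2"] by (simp only:)
qed

section \<open>Campbell's formulas for a Poisson random measure\<close>

locale poisson_measure = prob_space M for M :: "'w measure" +
  fixes N :: "'w \<Rightarrow> 'b measure" and \<mu> :: "'b measure"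
  assumes prm: "poisson_random_measure M N \<mu>"
begin

lemma sets_N: "\<omega> \<in> space M \<Longrightarrow> sets (N \<omega>) = sets \<mu>"
  using prm by (auto simp: poisson_random_measure_def)

lemma emeasure_N_measurable [measurable]:
  "A \<in> sets \<mu> \<Longrightarrow> (\<lambda>\<omega>. emeasure (N \<omega>) A) \<in> borel_measurable M"
  using prm by (auto simp: poisson_random_measure_def)

lemma indep_emeasure_N:
  fixes A :: "nat \<Rightarrow> 'b set"
  assumes "range A \<subseteq> sets \<mu>" "disjoint_family_on A {..<n}"
  shows "indep_vars (\<lambda>_. borel) (\<lambda>k \<omega>. emeasure (N \<omega>) (A k)) {..<n}"
  using prm assms unfolding poisson_random_measure_def by blast

text \<open>Infinite intensity is included on purpose: the level set of the value 0 of a simple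
  function may have infinite intensity and still occurs in the sums below, with coefficient
  0.\<close>

lemma emeasure_N_moments:
  assumes A: "A \<in> sets \<mu>"
  shows "(\<integral>\<^sup>+\<omega>. emeasure (N \<omega>) A \<partial>M) = emeasure \<mu> A"
    and "(\<integral>\<^sup>+\<omega>. (emeasure (N \<omega>) A)\<^sup>2 \<partial>M) = emeasure \<mu> A + (emeasure \<mu> A)\<^sup>2"
proof -
  have "(\<integral>\<^sup>+\<omega>. emeasure (N \<omega>) A \<partial>M) = emeasure \<mu> A \<and>
      (\<integral>\<^sup>+\<omega>. (emeasure (N \<omega>) A)\<^sup>2 \<partial>M) = emeasure \<mu> A + (emeasure \<mu> A)\<^sup>2"
  proof (cases "emeasure \<mu> A = \<infinity>")
    case True
    with prm A have "AE \<omega> in M. emeasure (N \<omega>) A = \<infinity>"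
      by (auto simp: poisson_random_measure_def)
    then have "(\<integral>\<^sup>+\<omega>. emeasure (N \<omega>) A \<partial>M) = (\<integral>\<^sup>+\<omega>. \<infinity> \<partial>M)"
      and "(\<integral>\<^sup>+\<omega>. (emeasure (N \<omega>) A)\<^sup>2 \<partial>M) = (\<integral>\<^sup>+\<omega>. \<infinity> \<partial>M)"
      by (intro nn_integral_cong_AE; eventually_elim; simp)+
    with True show ?thesis by (simp add: emeasure_space_1)
  next
    case False
    then have fin: "emeasure \<mu> A < \<infinity>" by (simp add: less_top)
    with prm A have "prob {\<omega> \<in> space M. emeasure (N \<omega>) A = of_nat k} =
        exp (- measure \<mu> A) * measure \<mu> A ^ k / fact k" for k :: nat
      by (auto simp: poisson_random_measure_def)
    from poisson_distributed_moments[OF emeasure_N_measurable[OF A] this] fin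
    show ?thesis by (simp add: emeasure_eq_ennreal_measure)
  qed
  then show "(\<integral>\<^sup>+\<omega>. emeasure (N \<omega>) A \<partial>M) = emeasure \<mu> A"
    and "(\<integral>\<^sup>+\<omega>. (emeasure (N \<omega>) A)\<^sup>2 \<partial>M) = emeasure \<mu> A + (emeasure \<mu> A)\<^sup>2" by auto
qed

lemma emeasure_N_mixed_moment:
  assumes "A \<in> sets \<mu>" "B \<in> sets \<mu>" "A \<inter> B = {}"
  shows "(\<integral>\<^sup>+\<omega>. emeasure (N \<omega>) A * emeasure (N \<omega>) B \<partial>M) = emeasure \<mu> A * emeasure \<mu> B"
proof -
  \<comment> \<open>Independence is available for sequences of sets; only the indices 0 and 1
    matter, so repeating \<open>B\<close> beyond them does not violate disjointness.\<close>
  define F where "F k = (if k = (0::nat) then A else B)" for k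
  have "indep_vars (\<lambda>_. borel) (\<lambda>k \<omega>. emeasure (N \<omega>) (F k)) {..<2}"
    using assms by (intro indep_emeasure_N) (auto simp: F_def disjoint_family_on_def)
  from indep_vars_nn_integral[OF _ this]
  show ?thesis using assms by (simp add: F_def numeral_2_eq_2 lessThan_Suc emeasure_N_moments mult.commute)
qed

text \<open>Being simple depends on the sigma-algebra alone, so the levels of \<open>f\<close> taken
  with respect to \<mu> serve for every \<open>N \<omega>\<close>.\<close>

lemma simple_function_nn_integral_N:
  assumes "simple_function \<mu> f" "\<omega> \<in> space M"
  shows "(\<integral>\<^sup>+u. f u \<partial>N \<omega>) = (\<Sum>y\<in>f ` space \<mu>. y * emeasure (N \<omega>) (f -` {y} \<inter> space \<mu>))"
proof -
  have "space (N \<omega>) = space \<mu>" using sets_N[OF assms(2)] by (rule sets_eq_imp_space_eq)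
  moreover have "simple_function (N \<omega>) f"
    using assms sets_N calculation by (subst simple_function_cong_algebra[where N = \<mu>]) auto
  ultimately show ?thesis
    by (simp add: nn_integral_eq_simple_integral simple_integral_def)
qed

lemma simple_function_nn_integral_N_moments:
  assumes f: "simple_function \<mu> f"
  shows "(\<lambda>\<omega>. \<integral>\<^sup>+u. f u \<partial>N \<omega>) \<in> borel_measurable M"
    and "(\<integral>\<^sup>+\<omega>. (\<integral>\<^sup>+u. f u \<partial>N \<omega>) \<partial>M) = (\<integral>\<^sup>+u. f u \<partial>\<mu>)"
    and "(\<integral>\<^sup>+\<omega>. (\<integral>\<^sup>+u. f u \<partial>N \<omega>)\<^sup>2 \<partial>M) = (\<integral>\<^sup>+u. (f u)\<^sup>2 \<partial>\<mu>) + (\<integral>\<^sup>+u. f u \<partial>\<mu>)\<^sup>2"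
proof -
  define Y where "Y = f ` space \<mu>"
  define F where "F y = f -` {y} \<inter> space \<mu>" for y
  have fin: "finite Y" and F [measurable]: "F y \<in> sets \<mu>" for y
    using f by (auto simp: Y_def F_def dest: simple_functionD)
  have disj: "y \<noteq> y' \<Longrightarrow> F y \<inter> F y' = {}" for y y'
    by (auto simp: F_def)
  have eq: "(\<integral>\<^sup>+u. f u \<partial>N \<omega>) = (\<Sum>y\<in>Y. y * emeasure (N \<omega>) (F y))" if "\<omega> \<in> space M" for \<omega>
    unfolding Y_def F_def using f that by (rule simple_function_nn_integral_N)
  have eq': "(\<integral>\<^sup>+u. f u \<partial>\<mu>) = (\<Sum>y\<in>Y. y * emeasure \<mu> (F y))"
    using f by (simp add: nn_integral_eq_simple_integral simple_integral_def Y_def F_def)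
  have "(\<integral>\<^sup>+u. (f u)\<^sup>2 \<partial>\<mu>) = (\<integral>\<^sup>+u. (\<Sum>y\<in>Y. y\<^sup>2 * indicator (F y) u) \<partial>\<mu>)"
  proof (rule nn_integral_cong)
    fix u assume u: "u \<in> space \<mu>"
    have "(\<Sum>y\<in>Y. y\<^sup>2 * indicator (F y) u) = (\<Sum>y\<in>{f u}. y\<^sup>2 * indicator (F y) u :: ennreal)"
      using fin u by (intro sum.mono_neutral_right) (auto simp: Y_def F_def)
    with u show "(f u)\<^sup>2 = (\<Sum>y\<in>Y. y\<^sup>2 * indicator (F y) u)" by (simp add: F_def)
  qed
  then have eq2: "(\<integral>\<^sup>+u. (f u)\<^sup>2 \<partial>\<mu>) = (\<Sum>y\<in>Y. y\<^sup>2 * emeasure \<mu> (F y))"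
    by (simp add: nn_integral_sum nn_integral_cmult)
  show "(\<lambda>\<omega>. \<integral>\<^sup>+u. f u \<partial>N \<omega>) \<in> borel_measurable M"
    by (subst measurable_cong[OF eq]) (auto intro!: borel_measurable_sum)
  show "(\<integral>\<^sup>+\<omega>. (\<integral>\<^sup>+u. f u \<partial>N \<omega>) \<partial>M) = (\<integral>\<^sup>+u. f u \<partial>\<mu>)"
    by (subst nn_integral_cong[OF eq])
      (auto simp: nn_integral_sum nn_integral_cmult eq' emeasure_N_moments)
  have "(\<integral>\<^sup>+\<omega>. (\<integral>\<^sup>+u. f u \<partial>N \<omega>)\<^sup>2 \<partial>M) =
      (\<integral>\<^sup>+\<omega>. (\<Sum>y\<in>Y. \<Sum>y'\<in>Y. y * y' * (emeasure (N \<omega>) (F y) * emeasure (N \<omega>) (F y'))) \<partial>M)"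
    by (rule nn_integral_cong) (simp add: eq power2_eq_square sum_product ac_simps)
  also have "\<dots> = (\<Sum>y\<in>Y. \<Sum>y'\<in>Y. y * y' * (\<integral>\<^sup>+\<omega>. emeasure (N \<omega>) (F y) * emeasure (N \<omega>) (F y') \<partial>M))"
    by (simp add: nn_integral_sum nn_integral_cmult)
  \<comment> \<open>A diagonal term is a second moment and exceeds the product of means by
    \<open>y\<^sup>2 * emeasure \<mu> (F y)\<close>; off the diagonal, independence gives exactly
    the product. The excess sums to the integral of the square.\<close>
  also have "\<dots> = (\<Sum>y\<in>Y. \<Sum>y'\<in>Y. (if y = y' then y\<^sup>2 * emeasure \<mu> (F y) else 0) +
      y * emeasure \<mu> (F y) * (y' * emeasure \<mu> (F y')))"
  proof (intro sum.cong refl)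
    fix y y'
    show "y * y' * (\<integral>\<^sup>+\<omega>. emeasure (N \<omega>) (F y) * emeasure (N \<omega>) (F y') \<partial>M) =
      (if y = y' then y\<^sup>2 * emeasure \<mu> (F y) else 0) + y * emeasure \<mu> (F y) * (y' * emeasure \<mu> (F y'))"
    proof (cases "y = y'")
      case True
      then show ?thesis using emeasure_N_moments(2)[OF F, of y]
        by (simp add: power2_eq_square distrib_left ac_simps)
    next
      case False
      then show ?thesis using emeasure_N_mixed_moment[OF F F disj] by (simp add: ac_simps)
    qed
  qed
  also have "\<dots> = (\<integral>\<^sup>+u. (f u)\<^sup>2 \<partial>\<mu>) + (\<integral>\<^sup>+u. f u \<partial>\<mu>)\<^sup>2"
    unfolding eq2 eq' power2_eq_square[of "sum _ _"] sum_product sum.distrib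
    using fin by (simp add: sum.delta)
  finally show "(\<integral>\<^sup>+\<omega>. (\<integral>\<^sup>+u. f u \<partial>N \<omega>)\<^sup>2 \<partial>M) = (\<integral>\<^sup>+u. (f u)\<^sup>2 \<partial>\<mu>) + (\<integral>\<^sup>+u. f u \<partial>\<mu>)\<^sup>2" .
qed

lemma
  assumes f: "f \<in> borel_measurable \<mu>"
  shows measurable_nn_integral_N: "(\<lambda>\<omega>. \<integral>\<^sup>+u. f u \<partial>N \<omega>) \<in> borel_measurable M"
    and nn_integral_nn_integral_N: "(\<integral>\<^sup>+\<omega>. (\<integral>\<^sup>+u. f u \<partial>N \<omega>) \<partial>M) = (\<integral>\<^sup>+u. f u \<partial>\<mu>)"
    and nn_integral_nn_integral_N_square:
      "(\<integral>\<^sup>+\<omega>. (\<integral>\<^sup>+u. f u \<partial>N \<omega>)\<^sup>2 \<partial>M) = (\<integral>\<^sup>+u. (f u)\<^sup>2 \<partial>\<mu>) + (\<integral>\<^sup>+u. f u \<partial>\<mu>)\<^sup>2"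
proof -
  obtain s where s: "\<And>i. simple_function \<mu> (s i)" "incseq s" "\<And>u. (SUP i. s i u) = f u"
    by (rule borel_measurable_implies_simple_function_sequence'[OF f]) (rule that)
  have [measurable]: "s i \<in> borel_measurable \<mu>" for i
    using s(1) by (rule borel_measurable_simple_function)
  have lim: "(\<lambda>i. s i u) \<longlonglongrightarrow> f u" for u
    using LIMSEQ_SUP[of "\<lambda>i. s i u"] s(2,3) by (simp add: incseq_def le_fun_def)
  have mono: "s i u \<le> s (Suc i) u" for i u
    using s(2) by (simp add: incseq_SucD le_funD)
  note simp_N = simple_function_nn_integral_N_moments[OF s(1)]
  have [measurable]: "(\<lambda>\<omega>. \<integral>\<^sup>+u. s i u \<partial>N \<omega>) \<in> borel_measurable M" for i by (rule simp_N)
  have lim_N: "(\<lambda>i. \<integral>\<^sup>+u. s i u \<partial>N \<omega>) \<longlonglongrightarrow> (\<integral>\<^sup>+u. f u \<partial>N \<omega>)" if "\<omega> \<in> space M" for \<omega>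
  proof (rule nn_integral_LIMSEQ)
    show "s i \<in> borel_measurable (N \<omega>)" for i
      by (subst measurable_cong_sets[OF sets_N[OF that] refl]) measurable
  qed (rule s(2) lim)+
  have mono_N: "(\<integral>\<^sup>+u. s i u \<partial>N \<omega>) \<le> (\<integral>\<^sup>+u. s (Suc i) u \<partial>N \<omega>)" for i \<omega>
    by (intro nn_integral_mono mono)
  show "(\<lambda>\<omega>. \<integral>\<^sup>+u. f u \<partial>N \<omega>) \<in> borel_measurable M"
    by (rule borel_measurable_LIMSEQ_order[of _ "\<lambda>i \<omega>. \<integral>\<^sup>+u. s i u \<partial>N \<omega>"]) (simp_all add: lim_N)
  note [measurable] = this
  have lim1: "(\<lambda>i. \<integral>\<^sup>+u. s i u \<partial>\<mu>) \<longlonglongrightarrow> (\<integral>\<^sup>+u. f u \<partial>\<mu>)"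
    by (rule nn_integral_LIMSEQ[OF s(2) _ lim]) measurable
  have lim2: "(\<lambda>i. \<integral>\<^sup>+u. (s i u)\<^sup>2 \<partial>\<mu>) \<longlonglongrightarrow> (\<integral>\<^sup>+u. (f u)\<^sup>2 \<partial>\<mu>)"
  proof (rule nn_integral_LIMSEQ)
    show "incseq (\<lambda>i u. (s i u)\<^sup>2)"
      by (intro incseq_SucI le_funI power_mono mono) simp
    show "(\<lambda>i. (s i u)\<^sup>2) \<longlonglongrightarrow> (f u)\<^sup>2" for u
      by (intro tendsto_power2_ennreal lim)
  qed measurable
  \<comment> \<open>The limit is written as a supremum because convergence to the integral of
    \<open>f\<close> is known on \<open>space M\<close> only, while the monotone convergence rule
    asks for every \<omega>.\<close>
  have sup_N: "(SUP i. \<integral>\<^sup>+u. s i u \<partial>N \<omega>) = (\<integral>\<^sup>+u. f u \<partial>N \<omega>)" if "\<omega> \<in> space M" for \<omega>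
    using LIMSEQ_unique[OF LIMSEQ_SUP lim_N[OF that]] mono_N by (simp add: incseq_Suc_iff)
  have lim_SUP: "(\<lambda>i. \<integral>\<^sup>+u. s i u \<partial>N \<omega>) \<longlonglongrightarrow> (SUP i. \<integral>\<^sup>+u. s i u \<partial>N \<omega>)" for \<omega>
    by (rule LIMSEQ_SUP) (simp add: incseq_Suc_iff mono_N)
  have "(\<lambda>i. \<integral>\<^sup>+\<omega>. (\<integral>\<^sup>+u. s i u \<partial>N \<omega>) \<partial>M) \<longlonglongrightarrow> (\<integral>\<^sup>+\<omega>. (SUP i. \<integral>\<^sup>+u. s i u \<partial>N \<omega>) \<partial>M)"
    by (rule nn_integral_LIMSEQ[OF _ _ lim_SUP]) (intro incseq_SucI le_funI mono_N, measurable)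
  then have "(\<lambda>i. \<integral>\<^sup>+u. s i u \<partial>\<mu>) \<longlonglongrightarrow> (\<integral>\<^sup>+\<omega>. (\<integral>\<^sup>+u. f u \<partial>N \<omega>) \<partial>M)"
    by (simp only: simp_N sup_N cong: nn_integral_cong)
  then show "(\<integral>\<^sup>+\<omega>. (\<integral>\<^sup>+u. f u \<partial>N \<omega>) \<partial>M) = (\<integral>\<^sup>+u. f u \<partial>\<mu>)"
    using lim1 by (rule LIMSEQ_unique)
  have "(\<lambda>i. \<integral>\<^sup>+\<omega>. (\<integral>\<^sup>+u. s i u \<partial>N \<omega>)\<^sup>2 \<partial>M) \<longlonglongrightarrow> (\<integral>\<^sup>+\<omega>. (SUP i. \<integral>\<^sup>+u. s i u \<partial>N \<omega>)\<^sup>2 \<partial>M)"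
  proof (rule nn_integral_LIMSEQ)
    show "incseq (\<lambda>i \<omega>. (\<integral>\<^sup>+u. s i u \<partial>N \<omega>)\<^sup>2)"
      by (intro incseq_SucI le_funI power_mono mono_N) simp
    show "(\<lambda>i. (\<integral>\<^sup>+u. s i u \<partial>N \<omega>)\<^sup>2) \<longlonglongrightarrow> (SUP i. \<integral>\<^sup>+u. s i u \<partial>N \<omega>)\<^sup>2" for \<omega>
      by (intro tendsto_power2_ennreal lim_SUP)
  qed measurable
  then have "(\<lambda>i. (\<integral>\<^sup>+u. (s i u)\<^sup>2 \<partial>\<mu>) + (\<integral>\<^sup>+u. s i u \<partial>\<mu>)\<^sup>2) \<longlonglongrightarrow>
      (\<integral>\<^sup>+\<omega>. (\<integral>\<^sup>+u. f u \<partial>N \<omega>)\<^sup>2 \<partial>M)"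
    by (simp only: simp_N sup_N cong: nn_integral_cong)
  moreover have "(\<lambda>i. (\<integral>\<^sup>+u. (s i u)\<^sup>2 \<partial>\<mu>) + (\<integral>\<^sup>+u. s i u \<partial>\<mu>)\<^sup>2) \<longlonglongrightarrow>
      (\<integral>\<^sup>+u. (f u)\<^sup>2 \<partial>\<mu>) + (\<integral>\<^sup>+u. f u \<partial>\<mu>)\<^sup>2"
    by (intro tendsto_add tendsto_power2_ennreal lim1 lim2)
  ultimately show "(\<integral>\<^sup>+\<omega>. (\<integral>\<^sup>+u. f u \<partial>N \<omega>)\<^sup>2 \<partial>M) = (\<integral>\<^sup>+u. (f u)\<^sup>2 \<partial>\<mu>) + (\<integral>\<^sup>+u. f u \<partial>\<mu>)\<^sup>2"
    by (rule LIMSEQ_unique)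
qed

text \<open>The measure itself varies with \<omega>, so measurability is read off from the
  nonnegative integrals of the two parts. The \<open>else\<close> branch reproduces the value 0 of
  the Bochner integral at non-integrable functions.\<close>

lemma measurable_integral_N:
  fixes f :: "'b \<Rightarrow> real"
  assumes [measurable]: "f \<in> borel_measurable \<mu>"
  shows "(\<lambda>\<omega>. LINT u|N \<omega>. f u) \<in> borel_measurable M"
proof -
  have f_N: "f \<in> borel_measurable (N \<omega>)" if "\<omega> \<in> space M" for \<omega>
    by (subst measurable_cong_sets[OF sets_N[OF that] refl]) measurable
  have eq: "(LINT u|N \<omega>. f u) = (if (\<integral>\<^sup>+u. ennreal (norm (f u)) \<partial>N \<omega>) < \<infinity>
      then enn2real (\<integral>\<^sup>+u. ennreal (f u) \<partial>N \<omega>) - enn2real (\<integral>\<^sup>+u. ennreal (- f u) \<partial>N \<omega>) else 0)"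
    if "\<omega> \<in> space M" for \<omega>
    using f_N[OF that]
    by (auto simp: integrable_iff_bounded real_lebesgue_integral_def not_integrable_integral_eq)
  note [measurable] = measurable_nn_integral_N
  show ?thesis
    by (subst measurable_cong[OF eq]) measurable
qed

lemma AE_integrable_N:
  fixes f :: "'b \<Rightarrow> real"
  assumes f: "integrable \<mu> f"
  shows "AE \<omega> in M. integrable (N \<omega>) f"
proof -
  have [measurable]: "f \<in> borel_measurable \<mu>" using f by auto
  have "(\<integral>\<^sup>+\<omega>. (\<integral>\<^sup>+u. ennreal (norm (f u)) \<partial>N \<omega>) \<partial>M) \<noteq> \<infinity>"
    using f by (subst nn_integral_nn_integral_N) (auto simp: integrable_iff_bounded)
  then have "AE \<omega> in M. (\<integral>\<^sup>+u. ennreal (norm (f u)) \<partial>N \<omega>) \<noteq> \<infinity>"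
    by (intro nn_integral_noteq_infinite measurable_nn_integral_N) auto
  with AE_space show ?thesis
  proof eventually_elim
    case (elim \<omega>)
    then have "f \<in> borel_measurable (N \<omega>)"
      by (subst measurable_cong_sets[OF sets_N refl]) auto
    with elim show ?case by (simp add: integrable_iff_bounded less_top)
  qed
qed

text \<open>Integration against \<open>N \<omega>\<close> is a contraction between the L1 spaces of
  \<mu> and M; truncation errors of jump integrals are controlled through this.\<close>

lemma nn_integral_abs_integral_N_le:
  fixes f :: "'b \<Rightarrow> real"
  assumes f: "integrable \<mu> f"
  shows "(\<integral>\<^sup>+\<omega>. ennreal \<bar>LINT u|N \<omega>. f u\<bar> \<partial>M) \<le> (\<integral>\<^sup>+u. ennreal \<bar>f u\<bar> \<partial>\<mu>)"
proof -
  have "(\<integral>\<^sup>+\<omega>. ennreal \<bar>LINT u|N \<omega>. f u\<bar> \<partial>M) \<le> (\<integral>\<^sup>+\<omega>. (\<integral>\<^sup>+u. ennreal \<bar>f u\<bar> \<partial>N \<omega>) \<partial>M)"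
    using AE_integrable_N[OF f] by (intro nn_integral_mono_AE; eventually_elim)
      (use integral_norm_bound_ennreal in fastforce)
  also have "\<dots> = (\<integral>\<^sup>+u. ennreal \<bar>f u\<bar> \<partial>\<mu>)"
    using f by (intro nn_integral_nn_integral_N) auto
  finally show ?thesis .
qed

lemma integrable_integral_N:
  fixes f :: "'b \<Rightarrow> real"
  assumes f: "integrable \<mu> f"
  shows "integrable M (\<lambda>\<omega>. LINT u|N \<omega>. f u)"
  unfolding integrable_iff_bounded
  using measurable_integral_N[of f] f le_less_trans[OF nn_integral_abs_integral_N_le[OF f]]
  by (auto simp: integrable_iff_bounded)

lemma nonneg_integral_N_moments:
  fixes f :: "'b \<Rightarrow> real"
  assumes f: "integrable \<mu> f" and nonneg: "\<And>u. 0 \<le> f u"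
  shows "expectation (\<lambda>\<omega>. LINT u|N \<omega>. f u) = (LINT u|\<mu>. f u)"
    and "integrable \<mu> (\<lambda>u. (f u)\<^sup>2) \<Longrightarrow> integrable M (\<lambda>\<omega>. (LINT u|N \<omega>. f u)\<^sup>2)"
    and "integrable \<mu> (\<lambda>u. (f u)\<^sup>2) \<Longrightarrow>
      expectation (\<lambda>\<omega>. (LINT u|N \<omega>. f u)\<^sup>2) = (LINT u|\<mu>. (f u)\<^sup>2) + (LINT u|\<mu>. f u)\<^sup>2"
proof -
  have [measurable]: "f \<in> borel_measurable \<mu>" using f by auto
  note [measurable] = measurable_integral_N[of f]
  let ?W = "\<lambda>\<omega>. LINT u|N \<omega>. f u"
  have W: "0 \<le> ?W \<omega>" for \<omega> by (rule integral_nonneg_AE) (simp add: nonneg)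
  have eq: "AE \<omega> in M. (\<integral>\<^sup>+u. ennreal (f u) \<partial>N \<omega>) = ennreal (?W \<omega>)"
    using AE_integrable_N[OF f] by eventually_elim (simp add: nn_integral_eq_integral nonneg)
  have eq': "(\<integral>\<^sup>+u. ennreal (f u) \<partial>\<mu>) = ennreal (LINT u|\<mu>. f u)"
    by (simp add: nn_integral_eq_integral nonneg f)
  have "(\<integral>\<^sup>+\<omega>. ennreal (?W \<omega>) \<partial>M) = (\<integral>\<^sup>+\<omega>. (\<integral>\<^sup>+u. ennreal (f u) \<partial>N \<omega>) \<partial>M)"
    by (rule nn_integral_cong_AE) (use eq in eventually_elim, simp)
  also have "\<dots> = ennreal (LINT u|\<mu>. f u)"
    by (simp add: nn_integral_nn_integral_N eq')
  finally show "expectation ?W = (LINT u|\<mu>. f u)"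
    by (subst integral_eq_nn_integral) (auto simp: W nonneg)
  assume f2: "integrable \<mu> (\<lambda>u. (f u)\<^sup>2)"
  have "(\<integral>\<^sup>+\<omega>. ennreal ((?W \<omega>)\<^sup>2) \<partial>M) = (\<integral>\<^sup>+\<omega>. (\<integral>\<^sup>+u. ennreal (f u) \<partial>N \<omega>)\<^sup>2 \<partial>M)"
    by (rule nn_integral_cong_AE) (use eq in eventually_elim, simp add: W ennreal_power)
  also have "\<dots> = (\<integral>\<^sup>+u. ennreal ((f u)\<^sup>2) \<partial>\<mu>) + (ennreal (LINT u|\<mu>. f u))\<^sup>2"
    by (simp add: nn_integral_nn_integral_N_square eq' nonneg ennreal_power)
  also have "\<dots> = ennreal ((LINT u|\<mu>. (f u)\<^sup>2) + (LINT u|\<mu>. f u)\<^sup>2)"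
    by (simp add: nn_integral_eq_integral f2 nonneg ennreal_power integral_nonneg_AE)
  finally have *: "(\<integral>\<^sup>+\<omega>. ennreal ((?W \<omega>)\<^sup>2) \<partial>M) = ennreal ((LINT u|\<mu>. (f u)\<^sup>2) + (LINT u|\<mu>. f u)\<^sup>2)" .
  then show "integrable M (\<lambda>\<omega>. (?W \<omega>)\<^sup>2)"
    by (auto simp: integrable_iff_bounded)
  show "expectation (\<lambda>\<omega>. (?W \<omega>)\<^sup>2) = (LINT u|\<mu>. (f u)\<^sup>2) + (LINT u|\<mu>. f u)\<^sup>2"
    by (subst integral_eq_nn_integral) (auto simp del: ennreal_plus simp: * integral_nonneg_AE)
qed

text \<open>Both parts are integrable against almost every \<open>N \<omega>\<close>. The identity
  for the absolute value is kept alongside because the second moment is computed from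
  \<open>P\<close>, \<open>Q\<close> and their sum.\<close>

lemma integral_N_decomposition:
  fixes f :: "'b \<Rightarrow> real"
  assumes f: "integrable \<mu> f"
  defines "P \<equiv> \<lambda>\<omega>. LINT u|N \<omega>. max 0 (f u)" and "Q \<equiv> \<lambda>\<omega>. LINT u|N \<omega>. max 0 (- f u)"
  shows "AE \<omega> in M. (LINT u|N \<omega>. f u) = P \<omega> - Q \<omega> \<and> (LINT u|N \<omega>. \<bar>f u\<bar>) = P \<omega> + Q \<omega>"
proof -
  have "integrable \<mu> (\<lambda>u. max 0 (f u))" "integrable \<mu> (\<lambda>u. max 0 (- f u))"
    using f by auto
  from this[THEN AE_integrable_N] show ?thesis
  proof eventually_elim
    case (elim \<omega>)
    have "f u = max 0 (f u) - max 0 (- f u)" "\<bar>f u\<bar> = max 0 (f u) + max 0 (- f u)" for u by auto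
    then have "(LINT u|N \<omega>. f u) = (LINT u|N \<omega>. max 0 (f u) - max 0 (- f u))"
      "(LINT u|N \<omega>. \<bar>f u\<bar>) = (LINT u|N \<omega>. max 0 (f u) + max 0 (- f u))"
      by (auto intro!: Bochner_Integration.integral_cong)
    with elim show ?case by (simp add: P_def Q_def)
  qed
qed

lemma expectation_integral_N:
  fixes f :: "'b \<Rightarrow> real"
  assumes f: "integrable \<mu> f"
  shows "expectation (\<lambda>\<omega>. LINT u|N \<omega>. f u) = (LINT u|\<mu>. f u)"
proof -
  let ?P = "\<lambda>\<omega>. LINT u|N \<omega>. max 0 (f u)" and ?Q = "\<lambda>\<omega>. LINT u|N \<omega>. max 0 (- f u)"
  have int: "integrable \<mu> (\<lambda>u. max 0 (f u))" "integrable \<mu> (\<lambda>u. max 0 (- f u))"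
    using f by auto
  note int_N = int[THEN integrable_integral_N]
  have "expectation (\<lambda>\<omega>. LINT u|N \<omega>. f u) = expectation (\<lambda>\<omega>. ?P \<omega> - ?Q \<omega>)"
    using integral_N_decomposition[OF f] int_N f
    by (intro integral_cong_AE) (auto intro: measurable_integral_N)
  also have "\<dots> = (LINT u|\<mu>. max 0 (f u)) - (LINT u|\<mu>. max 0 (- f u))"
    using int int_N by (simp add: nonneg_integral_N_moments(1))
  also have "\<dots> = (LINT u|\<mu>. max 0 (f u) - max 0 (- f u))"
    using int by simp
  also have "\<dots> = (LINT u|\<mu>. f u)"
    by (intro Bochner_Integration.integral_cong) auto
  finally show ?thesis .
qed

lemma
  fixes f :: "'b \<Rightarrow> real"
  assumes f: "integrable \<mu> f" and f2: "integrable \<mu> (\<lambda>u. (f u)\<^sup>2)"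
  shows integrable_integral_N_square: "integrable M (\<lambda>\<omega>. (LINT u|N \<omega>. f u)\<^sup>2)"
    and expectation_integral_N_square:
      "expectation (\<lambda>\<omega>. (LINT u|N \<omega>. f u)\<^sup>2) = (LINT u|\<mu>. (f u)\<^sup>2) + (LINT u|\<mu>. f u)\<^sup>2"
proof -
  define P where "P = (\<lambda>\<omega>. LINT u|N \<omega>. max 0 (f u))"
  define Q where "Q = (\<lambda>\<omega>. LINT u|N \<omega>. max 0 (- f u))"
  define R where "R = (\<lambda>\<omega>. LINT u|N \<omega>. \<bar>f u\<bar>)"
  have [measurable]: "f \<in> borel_measurable \<mu>" using f by auto
  have int: "integrable \<mu> (\<lambda>u. max 0 (f u))" "integrable \<mu> (\<lambda>u. max 0 (- f u))"
      "integrable \<mu> (\<lambda>u. \<bar>f u\<bar>)"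
    using f by auto
  have int2: "integrable \<mu> (\<lambda>u. (max 0 (f u))\<^sup>2)" "integrable \<mu> (\<lambda>u. (max 0 (- f u))\<^sup>2)"
      "integrable \<mu> (\<lambda>u. \<bar>f u\<bar>\<^sup>2)"
    by (rule Bochner_Integration.integrable_bound[OF f2]; auto simp: max_def)+
  have PQR: "integrable M (\<lambda>\<omega>. (P \<omega>)\<^sup>2)" "integrable M (\<lambda>\<omega>. (Q \<omega>)\<^sup>2)" "integrable M (\<lambda>\<omega>. (R \<omega>)\<^sup>2)"
    unfolding P_def Q_def R_def by (intro nonneg_integral_N_moments(2) int int2; simp)+
  \<comment> \<open>Polarization: the mixed moment of \<open>P\<close> and \<open>Q\<close> is obtained from that of the nonnegative \<open>R = P + Q\<close>.\<close>
  have eq: "AE \<omega> in M. (LINT u|N \<omega>. f u)\<^sup>2 = 2 * (P \<omega>)\<^sup>2 + 2 * (Q \<omega>)\<^sup>2 - (R \<omega>)\<^sup>2"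
    using integral_N_decomposition[OF f] unfolding P_def Q_def R_def
  proof eventually_elim
    case (elim \<omega>)
    have "(a - b)\<^sup>2 = 2 * a\<^sup>2 + 2 * b\<^sup>2 - (a + b)\<^sup>2" for a b :: real by algebra
    with elim show ?case by (simp only:)
  qed
  note [measurable] = measurable_integral_N
  have [measurable]: "P \<in> borel_measurable M" "Q \<in> borel_measurable M" "R \<in> borel_measurable M"
    unfolding P_def Q_def R_def by measurable
  have "integrable M (\<lambda>\<omega>. 2 * (P \<omega>)\<^sup>2 + 2 * (Q \<omega>)\<^sup>2 - (R \<omega>)\<^sup>2)"
    using PQR by auto
  then show "integrable M (\<lambda>\<omega>. (LINT u|N \<omega>. f u)\<^sup>2)"
    by (rule integrable_cong_AE_imp) (use eq in \<open>auto simp: eq_commute\<close>)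
  have P1: "(LINT u|\<mu>. max 0 (f u)) + (LINT u|\<mu>. max 0 (- f u)) = (LINT u|\<mu>. \<bar>f u\<bar>)"
    unfolding Bochner_Integration.integral_add[OF int(1,2), symmetric]
    by (rule Bochner_Integration.integral_cong) auto
  have M1: "(LINT u|\<mu>. max 0 (f u)) - (LINT u|\<mu>. max 0 (- f u)) = (LINT u|\<mu>. f u)"
    unfolding Bochner_Integration.integral_diff[OF int(1,2), symmetric]
    by (rule Bochner_Integration.integral_cong) auto
  \<comment> \<open>The two parts are never nonzero at the same point, so their squares add up
    without a mixed term.\<close>
  have P2: "(LINT u|\<mu>. (max 0 (f u))\<^sup>2) + (LINT u|\<mu>. (max 0 (- f u))\<^sup>2) = (LINT u|\<mu>. (f u)\<^sup>2)"
    unfolding Bochner_Integration.integral_add[OF int2(1,2), symmetric]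
    by (rule Bochner_Integration.integral_cong) (auto simp: max_def)
  have "expectation (\<lambda>\<omega>. (LINT u|N \<omega>. f u)\<^sup>2) =
      expectation (\<lambda>\<omega>. 2 * (P \<omega>)\<^sup>2 + 2 * (Q \<omega>)\<^sup>2 - (R \<omega>)\<^sup>2)"
    using eq by (intro integral_cong_AE) auto
  also have "\<dots> = 2 * expectation (\<lambda>\<omega>. (P \<omega>)\<^sup>2) + 2 * expectation (\<lambda>\<omega>. (Q \<omega>)\<^sup>2) - expectation (\<lambda>\<omega>. (R \<omega>)\<^sup>2)"
    using PQR by simp
  \<comment> \<open>With a, b the integrals of the two parts and a2, b2 those of their squares, the
    left side is \<open>2 * (a2 + a\<^sup>2) + 2 * (b2 + b\<^sup>2) - (a2 + b2 + (a +
    b)\<^sup>2)\<close>, which equals \<open>a2 + b2 + (a - b)\<^sup>2\<close>.\<close>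
  also have "\<dots> = (LINT u|\<mu>. (f u)\<^sup>2) + (LINT u|\<mu>. f u)\<^sup>2"
    using int int2 nonneg_integral_N_moments(3)[of "\<lambda>u. max 0 (f u)"]
      nonneg_integral_N_moments(3)[of "\<lambda>u. max 0 (- f u)"] nonneg_integral_N_moments(3)[of "\<lambda>u. \<bar>f u\<bar>"]
      P2
    unfolding P_def Q_def R_def M1[symmetric]
    by (simp add: P1[symmetric] power2_eq_square algebra_simps)
  finally show "expectation (\<lambda>\<omega>. (LINT u|N \<omega>. f u)\<^sup>2) = (LINT u|\<mu>. (f u)\<^sup>2) + (LINT u|\<mu>. f u)\<^sup>2" .
qed

end

section \<open>Uniform boundedness\<close>

text \<open>By Baire's theorem one of the sublevel sets of \<open>p\<close> contains a ball.\<close>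

lemma bounded_on_balls_if_closed_sublevels:
  fixes p :: "'b::banach \<Rightarrow> ennreal"
  assumes fin: "\<And>x. p x < \<infinity>"
    and closed: "\<And>n::nat. closed {x. p x \<le> of_nat n}"
    and sub: "\<And>x y. p (x - y) \<le> ennreal c * (p x + p y)"
    and scale: "\<And>a x. p (a *\<^sub>R x) = ennreal (\<bar>a\<bar> ^ k) * p x"
  shows "\<exists>B<\<infinity>. \<forall>x. norm x \<le> R \<longrightarrow> p x \<le> B"
proof -
  have "\<exists>n::nat. interior {x. p x \<le> of_nat n} \<noteq> {}"
  proof (rule ccontr)
    assume "\<not> ?thesis"
    moreover have "Met_TC.mcomplete TYPE('b)"
      unfolding Met_TC.mcomplete_def using Cauchy_convergent by (auto simp: convergent_def)
    ultimately have "interior (\<Union>n::nat. {x. p x \<le> of_nat n}) = {}"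
      using Met_TC.metric_Baire_category_alt[of "range (\<lambda>n::nat. {x. p x \<le> of_nat n})"] closed
      by auto
    moreover have "(\<Union>n::nat. {x. p x \<le> of_nat n}) = UNIV"
    proof -
      have "\<exists>n::nat. p x \<le> of_nat n" for x
      proof -
        obtain r where "p x = ennreal r" "0 \<le> r" using fin[of x] by (cases "p x") auto
        then show ?thesis
          using real_arch_simple[of r] by (auto simp: ennreal_of_nat_eq_real_of_nat)
      qed
      then show ?thesis by auto
    qed
    ultimately show False by simp
  qed
  then obtain n x0 e where e: "0 < e" "ball x0 e \<subseteq> {x. p x \<le> of_nat n}"
    by (auto simp: mem_interior)
  \<comment> \<open>Writing x as \<open>(x0 + x) - x0\<close> moves the ball from \<open>x0\<close>
    to the origin; both points lie in the sublevel set of n, and \<open>sub\<close> costs the factor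
    c.\<close>
  define B where "B = ennreal c * (of_nat n + of_nat n)"
  have ball: "p x \<le> B" if "norm x < e" for x
  proof -
    have "p x = p ((x0 + x) - x0)" by simp
    also have "\<dots> \<le> ennreal c * (p (x0 + x) + p x0)" by (rule sub)
    also have "\<dots> \<le> B"
      unfolding B_def using e that by (intro mult_left_mono add_mono) (auto simp: subset_iff dist_norm)
    finally show ?thesis .
  qed
  \<comment> \<open>Dilation carrying the ball of radius e onto the one of radius
    \<open>\<bar>R\<bar> + 1\<close>; this radius is positive for every R, and the summand 1 makes
    the inequality strict.\<close>
  define a where "a = (\<bar>R\<bar> + 1) / e"
  have a: "a > 0" using e by (simp add: a_def add_nonneg_pos)
  show ?thesis
  proof (intro exI[of _ "ennreal (\<bar>a\<bar> ^ k) * B"] conjI allI impI)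
    show "ennreal (\<bar>a\<bar> ^ k) * B < \<infinity>"
      by (simp add: B_def ennreal_mult_less_top of_nat_less_top)
    fix x :: 'b assume "norm x \<le> R"
    then have "norm x < \<bar>R\<bar> + 1" by simp
    then have "e * norm x < e * (\<bar>R\<bar> + 1)" using e by simp
    then have "norm (inverse a *\<^sub>R x) < e"
      using a e by (simp add: a_def divide_simps add_nonneg_pos ac_simps)
    from ball[OF this] have "ennreal (\<bar>a\<bar> ^ k) * p (inverse a *\<^sub>R x) \<le> ennreal (\<bar>a\<bar> ^ k) * B"
      by (rule mult_left_mono) simp
    then show "p x \<le> ennreal (\<bar>a\<bar> ^ k) * B"
      using a scale[of a "inverse a *\<^sub>R x"] by simp
  qed
qed

text \<open>A quasi-triangle inequality, from
  \<open>\<bar>a - b\<bar> \<le> 2 * max \<bar>a\<bar> \<bar>b\<bar>\<close>. The factor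
  \<open>2 ^ k\<close> is crude, but only its finiteness matters for the boundedness
  argument.\<close>

lemma abs_diff_power_le:
  fixes a b :: real
  shows "\<bar>a - b\<bar> ^ k \<le> 2 ^ k * (\<bar>a\<bar> ^ k + \<bar>b\<bar> ^ k)"
proof -
  have "\<bar>a - b\<bar> ^ k \<le> (2 * max \<bar>a\<bar> \<bar>b\<bar>) ^ k" by (rule power_mono) auto
  also have "\<dots> \<le> 2 ^ k * (\<bar>a\<bar> ^ k + \<bar>b\<bar> ^ k)"
    by (auto simp: power_mult_distrib max_def)
  finally show ?thesis .
qed

lemma blinfun_measurable [measurable]:
  fixes f :: "'a::real_normed_vector \<Rightarrow>\<^sub>L 'b::real_normed_vector"
  shows "blinfun_apply f \<in> borel_measurable borel"
  by (intro borel_measurable_continuous_onI continuous_intros)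

text \<open>Sublevel sets are closed because norm convergence of functionals is also pointwise
  convergence, to which Fatou's lemma applies. Degree k = 1 serves the mean and k = 2 the
  variance.\<close>

lemma weak_moment_bounded:
  fixes l :: "'a::real_normed_vector measure"
  assumes sets: "sets l = sets borel" and A: "A \<in> sets borel"
    and fin: "\<And>f :: 'a \<Rightarrow>\<^sub>L real. (\<integral>\<^sup>+z\<in>A. ennreal (\<bar>blinfun_apply f z\<bar> ^ k) \<partial>l) < \<infinity>"
  shows "\<exists>B<\<infinity>. \<forall>f :: 'a \<Rightarrow>\<^sub>L real. norm f \<le> R \<longrightarrow> (\<integral>\<^sup>+z\<in>A. ennreal (\<bar>blinfun_apply f z\<bar> ^ k) \<partial>l) \<le> B"
proof (rule bounded_on_balls_if_closed_sublevels)
  note [measurable_cong] = sets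
  have [measurable]: "A \<in> sets l" using A sets by simp
  let ?p = "\<lambda>f :: 'a \<Rightarrow>\<^sub>L real. \<integral>\<^sup>+z\<in>A. ennreal (\<bar>f z\<bar> ^ k) \<partial>l"
  show "?p f < \<infinity>" for f by (rule fin)
  show "closed {f. ?p f \<le> of_nat n}" for n
    unfolding closed_sequential_limits
  proof (intro allI impI, elim conjE)
    fix F :: "nat \<Rightarrow> 'a \<Rightarrow>\<^sub>L real" and f
    assume F: "\<forall>i. F i \<in> {f. ?p f \<le> of_nat n}" and lim: "F \<longlonglongrightarrow> f"
    have pointwise: "(\<lambda>i. ennreal (\<bar>F i z\<bar> ^ k) * indicator A z) \<longlonglongrightarrow> ennreal (\<bar>f z\<bar> ^ k) * indicator A z" for z
    proof -
      have "(\<lambda>i. F i z) \<longlonglongrightarrow> f z" by (rule blinfun.tendsto[OF lim tendsto_const])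
      then have "(\<lambda>i. ennreal (\<bar>F i z\<bar> ^ k)) \<longlonglongrightarrow> ennreal (\<bar>f z\<bar> ^ k)"
        by (intro tendsto_ennrealI tendsto_power tendsto_rabs)
      then show ?thesis by (cases "z \<in> A") auto
    qed
    have "?p f = (\<integral>\<^sup>+z. liminf (\<lambda>i. ennreal (\<bar>F i z\<bar> ^ k) * indicator A z) \<partial>l)"
      by (simp only: lim_imp_Liminf[OF sequentially_bot pointwise])
    also have "\<dots> \<le> liminf (\<lambda>i. ?p (F i))"
      by (intro nn_integral_liminf) measurable
    also have "\<dots> \<le> liminf (\<lambda>i. of_nat n)"
      using F by (intro Liminf_mono) auto
    finally show "f \<in> {f. ?p f \<le> of_nat n}" by (simp add: Liminf_const)
  qed
  show "?p (f - g) \<le> ennreal (2 ^ k) * (?p f + ?p g)" for f g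
  proof -
    have "?p (f - g) \<le> (\<integral>\<^sup>+z. ennreal (2 ^ k) * (ennreal (\<bar>f z\<bar> ^ k) * indicator A z +
        ennreal (\<bar>g z\<bar> ^ k) * indicator A z) \<partial>l)"
      using abs_diff_power_le
      by (intro nn_integral_mono)
        (auto simp: blinfun.diff_left indicator_def simp flip: ennreal_plus ennreal_mult' intro!: ennreal_leI)
    also have "\<dots> = ennreal (2 ^ k) * (?p f + ?p g)"
      by (subst nn_integral_cmult; (subst nn_integral_add)?; simp)
    finally show ?thesis .
  qed
  show "?p (a *\<^sub>R f) = ennreal (\<bar>a\<bar> ^ k) * ?p f" for a f
    by (subst nn_integral_cmult[symmetric])
      (auto simp: blinfun.scaleR_left abs_mult power_mult_distrib ennreal_mult ac_simps)
qed

text \<open>Orbits are continuous, but \<open>S\<close> need not be continuous in operator norm. The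
  Baire argument is applied to the supremum of the orbit norm over \<open>{0..t}\<close>: it is
  finite by compactness, and its sublevel sets are intersections of closed sets.\<close>

lemma strongly_continuous_semigroup_bounded:
  fixes S :: "real \<Rightarrow> 'b::banach \<Rightarrow>\<^sub>L 'b"
  assumes S: "strongly_continuous_semigroup S"
  shows "\<exists>B\<ge>0. \<forall>s\<in>{0..t}. norm (S s) \<le> B"
proof -
  have cont: "continuous_on {0..t} (\<lambda>s. S s x)" for x
    using S by (auto simp: strongly_continuous_semigroup_def intro: continuous_on_subset)
  define p where "p x = (SUP s\<in>{0..t}. ennreal (norm (S s x)))" for x
  have "\<exists>B<\<infinity>. \<forall>x. norm x \<le> 1 \<longrightarrow> p x \<le> B"
  proof (rule bounded_on_balls_if_closed_sublevels[where c = 1 and k = 1])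
    show "p x < \<infinity>" for x
    proof -
      have "bounded ((\<lambda>s. S s x) ` {0..t})"
        by (intro compact_imp_bounded compact_continuous_image cont) auto
      then obtain b where "\<And>s. s \<in> {0..t} \<Longrightarrow> norm (S s x) \<le> b" unfolding bounded_iff by blast
      then have "p x \<le> ennreal b" unfolding p_def by (intro SUP_least ennreal_leI)
      then show ?thesis by (rule le_less_trans) simp
    qed
    show "closed {x. p x \<le> of_nat n}" for n
    proof -
      have "{x. p x \<le> of_nat n} = (\<Inter>s\<in>{0..t}. {x. norm (S s x) \<le> real n})"
        by (auto simp: p_def SUP_le_iff ennreal_of_nat_eq_real_of_nat)
      then show ?thesis by (auto intro!: closed_Collect_le continuous_intros)
    qed
    show "p (x - y) \<le> ennreal 1 * (p x + p y)" for x y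
    proof -
      have "ennreal (norm (S s (x - y))) \<le> p x + p y" if "s \<in> {0..t}" for s
      proof -
        have "ennreal (norm (S s (x - y))) \<le> ennreal (norm (S s x)) + ennreal (norm (S s y))"
          by (simp add: blinfun.diff_right norm_triangle_ineq4 flip: ennreal_plus)
        also have "\<dots> \<le> p x + p y"
          unfolding p_def using that by (intro add_mono SUP_upper)
        finally show ?thesis .
      qed
      then show ?thesis unfolding p_def[of "x - y"] by (simp add: SUP_le_iff)
    qed
    show "p (a *\<^sub>R x) = ennreal (\<bar>a\<bar> ^ 1) * p x" for a x
      by (simp add: p_def blinfun.scaleR_right ennreal_mult SUP_mult_left_ennreal)
  qed
  then obtain B where B: "B < \<infinity>" "\<And>x. norm x \<le> 1 \<Longrightarrow> p x \<le> B" by auto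
  then obtain b where b: "B = ennreal b" "0 \<le> b" by (cases B) auto
  have "norm (S s) \<le> b" if s: "s \<in> {0..t}" for s
  proof (rule norm_blinfun_bound[OF b(2)])
    fix x show "norm (S s x) \<le> b * norm x"
    proof (cases "x = 0")
      case False
      have "ennreal (norm (S s (x /\<^sub>R norm x))) \<le> p (x /\<^sub>R norm x)"
        unfolding p_def using s by (rule SUP_upper)
      also have "\<dots> \<le> ennreal b" using B(2)[of "x /\<^sub>R norm x"] b(1) False by simp
      finally have "norm (S s x) / norm x \<le> b"
        using b(2) by (simp add: blinfun.scaleR_right divide_inverse_commute)
      with False show ?thesis by (simp add: field_simps)
    qed simp
  qed
  with b(2) show ?thesis by blast
qed

section \<open>Integration against the jump intensity\<close>

text \<open>The mass may be infinite near 0, but the complements of the closed balls of radius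
  \<open>1 / (n + 1)\<close> have finite mass and together miss only the origin, a null set.\<close>

lemma sigma_finite_levy_measure:
  fixes l :: "'a::real_normed_vector measure"
  assumes "levy_measure l"
  shows "sigma_finite_measure l"
proof
  have sets: "sets l = sets borel" and zero: "emeasure l {0} = 0"
    and fin: "\<And>r. 0 < r \<Longrightarrow> emeasure l {z. r < norm z} < \<infinity>"
    using assms by (auto simp: levy_measure_def)
  note [measurable_cong] = sets
  let ?A = "\<lambda>n::nat. {z::'a. 1 / real (Suc n) < norm z}"
  have "?A n \<in> sets l" for n by (simp add: sets)
  moreover have "\<Union> (insert {0} (range ?A)) = UNIV"
  proof -
    have "\<exists>n. 1 / real (Suc n) < norm z" if "z \<noteq> 0" for z :: 'a
      using reals_Archimedean[of "norm z"] that by (auto simp: inverse_eq_divide)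
    then show ?thesis by auto
  qed
  moreover have "emeasure l (?A n) \<noteq> \<infinity>" for n
    using fin[of "1 / real (Suc n)"] by (simp add: less_top)
  ultimately show "\<exists>A. countable A \<and> A \<subseteq> sets l \<and> \<Union> A = space l \<and> (\<forall>a\<in>A. emeasure l a \<noteq> \<infinity>)"
    using zero by (intro exI[of _ "insert {0} (range ?A)"])
      (auto simp: sets sets_eq_imp_space_eq[OF sets])
qed

lemma sigma_finite_positive_time:
  "sigma_finite_measure (density lborel (indicator {0<..} :: real \<Rightarrow> ennreal))"
  by (subst sigma_finite_measure.sigma_finite_iff_density_finite[OF sigma_finite_lborel])
    (auto simp: indicator_def intro!: borel_measurable_indicator)

lemma sets_jump_intensity:
  "levy_measure l \<Longrightarrow> sets (jump_intensity l) = sets (borel \<Otimes>\<^sub>M borel)"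
  unfolding jump_intensity_def levy_measure_def by (intro sets_pair_measure_cong) auto

lemma nn_integral_jump_intensity:
  fixes l :: "'a::real_normed_vector measure"
  assumes l: "levy_measure l" and f: "f \<in> borel_measurable (borel \<Otimes>\<^sub>M borel)"
  shows "(\<integral>\<^sup>+u. f u \<partial>jump_intensity l) = (\<integral>\<^sup>+s. indicator {0<..} s * (\<integral>\<^sup>+z. f (s, z) \<partial>l) \<partial>lborel)"
proof -
  interpret sigma_finite_measure l using l by (rule sigma_finite_levy_measure)
  let ?M = "density lborel (indicator {0<..} :: real \<Rightarrow> ennreal)"
  have f': "f \<in> borel_measurable (?M \<Otimes>\<^sub>M l)"
    using f sets_jump_intensity[OF l] measurable_cong_sets unfolding jump_intensity_def by blast
  have "(\<integral>\<^sup>+u. f u \<partial>jump_intensity l) = (\<integral>\<^sup>+s. (\<integral>\<^sup>+z. f (s, z) \<partial>l) \<partial>?M)"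
    unfolding jump_intensity_def by (rule nn_integral_fst[OF f', symmetric])
  also have "\<dots> = (\<integral>\<^sup>+s. indicator {0<..} s * (\<integral>\<^sup>+z. f (s, z) \<partial>l) \<partial>lborel)"
  proof (rule nn_integral_density)
    show "(indicator {0<..} :: real \<Rightarrow> ennreal) \<in> borel_measurable lborel"
      by (intro borel_measurable_indicator) simp
    show "(\<lambda>s. \<integral>\<^sup>+z. f (s, z) \<partial>l) \<in> borel_measurable lborel"
      using borel_measurable_nn_integral_fst[OF f'] by simp
  qed
  finally show ?thesis .
qed

lemma
  fixes l :: "'a::real_normed_vector measure" and \<phi> :: "real \<times> 'a \<Rightarrow> real"
  assumes l: "levy_measure l" and t: "0 \<le> t"
    and int: "set_integrable (jump_intensity l) ({0<..t} \<times> Z) \<phi>"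
  shows jump_intensity_integrable_fst: "set_integrable lborel {0..t} (\<lambda>s. LINT z:Z|l. \<phi> (s, z))"
    and jump_intensity_integral_fst:
      "(LINT u:{0<..t} \<times> Z|jump_intensity l. \<phi> u) = (LINT s:{0..t}|lborel. LINT z:Z|l. \<phi> (s, z))"
proof -
  \<comment> \<open>Bochner integration against a density expects a real density embedded in
    \<open>ennreal\<close>, so the indicator is put in this form.\<close>
  let ?M = "density lborel (\<lambda>s::real. ennreal (indicator {0<..} s))"
  have M: "density lborel (indicator {0<..}) = ?M"
    by (rule arg_cong[where f = "density lborel"]) (simp add: fun_eq_iff indicator_def)
  have "sigma_finite_measure ?M"
    using sigma_finite_positive_time by (simp only: M)
  then interpret pair_sigma_finite ?M l
    using sigma_finite_levy_measure[OF l] by (rule pair_sigma_finite.intro)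
  let ?f = "\<lambda>u. indicator ({0<..t} \<times> Z) u *\<^sub>R \<phi> u"
  let ?F = "\<lambda>s. LINT z:Z|l. \<phi> (s, z)"
  have f: "integrable (?M \<Otimes>\<^sub>M l) ?f"
    using int by (simp add: set_integrable_def jump_intensity_def M)
  have eq: "(LINT z|l. ?f (s, z)) = indicator {0<..t} s *\<^sub>R ?F s" for s
    by (cases "s \<in> {0<..t}") (auto simp: set_lebesgue_integral_def indicator_def intro!: Bochner_Integration.integral_cong)
  have int_M: "integrable ?M (\<lambda>s. indicator {0<..t} s *\<^sub>R ?F s)"
    using integrable_fst'[OF f] by (simp only: eq)
  have meas: "(\<lambda>s. indicator {0<..t} s *\<^sub>R ?F s) \<in> borel_measurable lborel"
    using borel_measurable_integrable[OF int_M] by (simp only: measurable_density_eq1)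
  have "integrable lborel (\<lambda>s. indicator {0<..} s *\<^sub>R (indicator {0<..t} s *\<^sub>R ?F s))"
    using int_M by (subst (asm) integrable_density[OF meas]) auto
  \<comment> \<open>The intensity lives on positive times, hence the half-open interval; passing to
    \<open>{0..t}\<close> alters the integrand on the null set \<open>{0}\<close> only.\<close>
  then show "set_integrable lborel {0..t} ?F"
    unfolding set_integrable_def
    by (subst (asm) integrable_discrete_difference[where X = "{0}" and g = "\<lambda>s. indicator {0..t} s *\<^sub>R ?F s"])
      (auto simp: indicator_def)
  have "(LINT u:{0<..t} \<times> Z|jump_intensity l. \<phi> u) = (LINT s|?M. indicator {0<..t} s *\<^sub>R ?F s)"
    using integral_fst'[OF f] unfolding eq by (simp add: set_lebesgue_integral_def jump_intensity_def M)
  also have "\<dots> = (LINT s|lborel. indicator {0<..} s *\<^sub>R (indicator {0<..t} s *\<^sub>R ?F s))"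
    by (rule integral_density[OF meas]) auto
  also have "\<dots> = (LINT s:{0..t}|lborel. ?F s)"
    unfolding set_lebesgue_integral_def
    by (rule integral_discrete_difference[where X = "{0}"]) (auto simp: indicator_def)
  finally show "(LINT u:{0<..t} \<times> Z|jump_intensity l. \<phi> u) = (LINT s:{0..t}|lborel. ?F s)" .
qed

text \<open>Continuity in s for each fixed z becomes joint continuity: in the split
  \<open>f s w = f s z + f s (w - z)\<close> the first term converges by hypothesis and the second
  is at most \<open>b * norm (w - z)\<close>. Second countability identifies the product of the
  Borel algebras with the Borel algebra of the product.\<close>

lemma blinfun_family_measurable:
  fixes f :: "real \<Rightarrow> 'a::{real_normed_vector,second_countable_topology} \<Rightarrow>\<^sub>L real"
  assumes cont: "\<And>z. continuous_on {0..t} (\<lambda>s. f s z)"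
    and bound: "\<And>s. s \<in> {0..t} \<Longrightarrow> norm (f s) \<le> b"
  shows "(\<lambda>u. indicator ({0..t} \<times> UNIV) u *\<^sub>R f (fst u) (snd u)) \<in> borel_measurable (borel \<Otimes>\<^sub>M borel)"
proof -
  have "continuous_on ({0..t} \<times> UNIV) (\<lambda>u. f (fst u) (snd u))"
    unfolding continuous_on_def
  proof (rule ballI)
    fix v :: "real \<times> 'a" assume "v \<in> {0..t} \<times> UNIV"
    then obtain s z where v: "v = (s, z)" and s: "0 \<le> s" "s \<le> t" by (cases v) auto
    let ?F = "at (s, z) within {0..t} \<times> UNIV"
    have "((\<lambda>u. f (fst u) z) \<longlongrightarrow> f s z) ?F"
    proof -
      have "continuous_on ({0..t} \<times> (UNIV :: 'a set)) (\<lambda>u. f (fst u) z)"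
        by (rule continuous_on_compose2[OF cont]) (auto intro!: continuous_intros)
      then show ?thesis using s by (auto simp: continuous_on_def)
    qed
    moreover have "((\<lambda>u. f (fst u) (snd u - z)) \<longlongrightarrow> 0) ?F"
    proof (rule Lim_null_comparison)
      have "\<forall>\<^sub>F u in ?F. u \<in> {0..t} \<times> UNIV" by (simp add: eventually_at_filter)
      then show "\<forall>\<^sub>F u in ?F. norm (f (fst u) (snd u - z)) \<le> b * norm (snd u - z)"
      proof eventually_elim
        case (elim u)
        then have "norm (f (fst u) (snd u - z)) \<le> norm (f (fst u)) * norm (snd u - z)"
          by (intro norm_blinfun)
        also have "\<dots> \<le> b * norm (snd u - z)"
          using elim by (intro mult_right_mono bound) auto
        finally show ?case .
      qed
      have "((\<lambda>u. b * norm (snd u - z)) \<longlongrightarrow> b * norm (snd (s, z) - z)) ?F"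
        by (intro tendsto_intros)
      then show "((\<lambda>u. b * norm (snd u - z)) \<longlongrightarrow> 0) ?F" by simp
    qed
    ultimately have "((\<lambda>u. f (fst u) z + f (fst u) (snd u - z)) \<longlongrightarrow> f s z + 0) ?F"
      by (rule tendsto_add)
    then show "((\<lambda>u. f (fst u) (snd u)) \<longlongrightarrow> f (fst v) (snd v)) (at v within {0..t} \<times> UNIV)"
      by (simp add: v blinfun.diff_right)
  qed
  then show ?thesis
    unfolding borel_prod by (intro borel_measurable_continuous_on_indicator borel_closed closed_Times) auto
qed

text \<open>All functionals \<open>f s\<close> lie in one ball of the dual space, so their weak
  moments of order k have a common bound \<open>B\<close>, and Tonelli bounds the integral by
  \<open>B * t\<close>.\<close>

lemma blinfun_family_integrable:
  fixes f :: "real \<Rightarrow> 'a::{real_normed_vector,second_countable_topology} \<Rightarrow>\<^sub>L real"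
  assumes l: "levy_measure l" and t: "0 \<le> t"
    and cont: "\<And>z. continuous_on {0..t} (\<lambda>s. f s z)"
    and bound: "\<And>s. s \<in> {0..t} \<Longrightarrow> norm (f s) \<le> b"
    and moment: "\<And>f :: 'a \<Rightarrow>\<^sub>L real. (\<integral>\<^sup>+z. ennreal (\<bar>blinfun_apply f z\<bar> ^ k) \<partial>l) < \<infinity>"
  shows "set_integrable (jump_intensity l) ({0<..t} \<times> UNIV) (\<lambda>(s, z). f s z ^ k)"
proof -
  have sets_l: "sets l = sets borel" using l by (simp add: levy_measure_def)
  obtain B where B: "B < \<infinity>" "\<And>f :: 'a \<Rightarrow>\<^sub>L real. norm f \<le> b \<Longrightarrow> (\<integral>\<^sup>+z. ennreal (\<bar>blinfun_apply f z\<bar> ^ k) \<partial>l) \<le> B"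
    using weak_moment_bounded[OF sets_l, of UNIV k b] moment by auto
  let ?f = "\<lambda>u. indicator ({0<..t} \<times> UNIV) u *\<^sub>R f (fst u) (snd u) ^ k"
  have meas: "?f \<in> borel_measurable (borel \<Otimes>\<^sub>M borel)"
  proof -
    note [measurable] = blinfun_family_measurable[OF cont bound]
    \<comment> \<open>The inner indicator forms the function already known to be measurable; the
      outer one removes time 0.\<close>
    have "?f = (\<lambda>u. indicator ({0<..t} \<times> UNIV) u *\<^sub>R (indicator ({0..t} \<times> UNIV) u *\<^sub>R f (fst u) (snd u)) ^ k)"
      by (auto simp: indicator_def fun_eq_iff)
    also have "\<dots> \<in> borel_measurable (borel \<Otimes>\<^sub>M borel)" by measurable
    finally show ?thesis .
  qed
  have "(\<integral>\<^sup>+u. ennreal (norm (?f u)) \<partial>jump_intensity l) =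
      (\<integral>\<^sup>+s. indicator {0<..} s * (\<integral>\<^sup>+z. ennreal (norm (?f (s, z))) \<partial>l) \<partial>lborel)"
    using meas by (intro nn_integral_jump_intensity[OF l]) auto
  also have "\<dots> \<le> (\<integral>\<^sup>+s. B * indicator {0..t} s \<partial>lborel)"
  proof (rule nn_integral_mono)
    fix s
    show "indicator {0<..} s * (\<integral>\<^sup>+z. ennreal (norm (?f (s, z))) \<partial>l) \<le> B * indicator {0..t} s"
    proof (cases "s \<in> {0<..t}")
      case True
      then have "(\<integral>\<^sup>+z. ennreal (\<bar>f s z\<bar> ^ k) \<partial>l) \<le> B" by (intro B bound) auto
      with True show ?thesis by (simp add: power_abs)
    qed (auto simp: indicator_def)
  qed
  also have "\<dots> = B * ennreal t" using t by (simp add: nn_integral_cmult)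
  also have "\<dots> < \<infinity>" using B by (simp add: ennreal_mult_less_top)
  finally have "integrable (jump_intensity l) ?f"
    unfolding integrable_iff_bounded measurable_cong_sets[OF sets_jump_intensity[OF l] refl]
    using meas by simp
  then show ?thesis by (simp add: set_integrable_def case_prod_beta)
qed


text \<open>The truncated integrals converge in \<open>L\<^sup>1\<close> as well as in \<open>L\<^sup>2\<close>, so the two limits agree.\<close>

lemma AE_compensated_integral_eq:
  fixes \<phi> :: "real \<times> 'a::real_normed_vector \<Rightarrow> real"
  assumes prm: "poisson_measure M N \<mu>"
    and sets: "sets \<mu> = sets (borel \<Otimes>\<^sub>M borel)"
    and int: "set_integrable \<mu> ({0<..t} \<times> {z. 0 < norm z \<and> norm z \<le> 1}) \<phi>"
    and J: "has_compensated_integral M N \<mu> t \<phi> J"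
  shows "AE \<omega> in M. J \<omega> =
      (LINT u:{0<..t} \<times> {z. 0 < norm z \<and> norm z \<le> 1}|N \<omega>. \<phi> u) -
      (LINT u:{0<..t} \<times> {z. 0 < norm z \<and> norm z \<le> 1}|\<mu>. \<phi> u)"
proof -
  interpret poisson_measure M N \<mu> by (rule prm)
  define A where "A \<epsilon> = {0<..t} \<times> {z::'a. \<epsilon> < norm z \<and> norm z \<le> 1}" for \<epsilon>
  have A_sets [measurable]: "A \<epsilon> \<in> sets \<mu>" for \<epsilon>
    unfolding sets A_def by (intro pair_measureI) simp_all
  \<comment> \<open>Dominated convergence needs a sequence of truncation levels, and the limit
    defining the compensated integral is taken at \<open>at_right 0\<close>, so the levels must stay
    positive.\<close>
  define e where "e n = 1 / real (Suc n)" for n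
  have e: "0 < e n" for n by (simp add: e_def)
  have e_lim: "e \<longlonglongrightarrow> 0"
    using LIMSEQ_Suc[OF lim_1_over_n[where 'a = real]] by (simp only: e_def[abs_def])
  define Z where "Z \<epsilon> \<omega> = (LINT u:A \<epsilon>|N \<omega>. \<phi> u) - (LINT u:A \<epsilon>|\<mu>. \<phi> u)" for \<epsilon> \<omega>
  \<comment> \<open>The truncation remainder: the part of \<phi> on jumps with
    \<open>norm z \<le> e n\<close>. At each point it is eventually zero.\<close>
  define G where "G n u = indicator (A 0) u *\<^sub>R \<phi> u - indicator (A (e n)) u *\<^sub>R \<phi> u" for n u
  have int0: "integrable \<mu> (\<lambda>u. indicator (A 0) u *\<^sub>R \<phi> u)"
    using int by (simp add: set_integrable_def A_def)
  have sub: "A (e n) \<subseteq> A 0" for n using e[of n] by (auto simp: A_def)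
  have int_e: "integrable \<mu> (\<lambda>u. indicator (A (e n)) u *\<^sub>R \<phi> u)" for n
    using set_integrable_subset[of \<mu> "A 0" \<phi> "A (e n)"] int0 sub by (simp add: set_integrable_def)
  have int_G: "integrable \<mu> (G n)" for n
    unfolding G_def using int0 int_e by (rule Bochner_Integration.integrable_diff)
  define r where "r n = (\<integral>\<^sup>+u. ennreal \<bar>G n u\<bar> \<partial>\<mu>)" for n
  have "r \<longlonglongrightarrow> (\<integral>\<^sup>+u. 0 \<partial>\<mu>)"
    unfolding r_def
  proof (rule nn_integral_dominated_convergence)
    show "(\<lambda>u. ennreal \<bar>G n u\<bar>) \<in> borel_measurable \<mu>" for n using int_G[of n] by auto
    show "(\<lambda>u. ennreal \<bar>indicator (A 0) u *\<^sub>R \<phi> u\<bar>) \<in> borel_measurable \<mu>" using int0 by auto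
    show "(\<integral>\<^sup>+u. ennreal \<bar>indicator (A 0) u *\<^sub>R \<phi> u\<bar> \<partial>\<mu>) < \<infinity>"
      using int0 by (simp add: integrable_iff_bounded)
    show "AE u in \<mu>. ennreal \<bar>G n u\<bar> \<le> ennreal \<bar>indicator (A 0) u *\<^sub>R \<phi> u\<bar>" for n
      using sub[of n] by (intro AE_I2 ennreal_leI) (auto simp: G_def indicator_def)
    show "AE u in \<mu>. (\<lambda>n. ennreal \<bar>G n u\<bar>) \<longlonglongrightarrow> 0"
    proof (rule AE_I2, rule tendsto_eventually)
      fix u
      show "\<forall>\<^sub>F n in sequentially. ennreal \<bar>G n u\<bar> = 0"
      proof (cases "u \<in> A 0")
        case True
        then have "\<forall>\<^sub>F n in sequentially. e n < norm (snd u)"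
          by (intro order_tendstoD(2)[OF e_lim]) (auto simp: A_def)
        then show ?thesis
          by eventually_elim (use True in \<open>auto simp: G_def A_def indicator_def\<close>)
      next
        case False
        with sub have "u \<notin> A (e n)" for n by blast
        with False show ?thesis by (simp add: G_def)
      qed
    qed
  qed simp
  then have r: "r \<longlonglongrightarrow> 0" by simp
  define d where "d n = (\<integral>\<^sup>+\<omega>. ennreal ((J \<omega> - Z (e n) \<omega>)\<^sup>2) \<partial>M)" for n
  have "filterlim e (at_right 0) sequentially"
    unfolding filterlim_at using e e_lim by (auto simp: less_imp_neq[symmetric])
  then have d: "d \<longlonglongrightarrow> 0"
    using J unfolding has_compensated_integral_def d_def Z_def A_def
    by (auto intro: filterlim_compose)
  have [measurable]: "J \<in> borel_measurable M"
    using J by (simp add: has_compensated_integral_def)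
  have meas_N: "(\<lambda>\<omega>. LINT u:B|N \<omega>. \<phi> u) \<in> borel_measurable M"
    if "integrable \<mu> (\<lambda>u. indicator B u *\<^sub>R \<phi> u)" for B
    unfolding set_lebesgue_integral_def using that by (intro measurable_integral_N) auto
  have [measurable]: "Z (e n) \<in> borel_measurable M" "Z 0 \<in> borel_measurable M" for n
    unfolding Z_def by (intro borel_measurable_diff meas_N int_e int0 borel_measurable_const)+
  \<comment> \<open>The remainder enters twice, through \<open>N \<omega>\<close> and through the
    compensator, and each contributes at most \<open>r n\<close>.\<close>
  have diff: "(\<integral>\<^sup>+\<omega>. ennreal \<bar>Z 0 \<omega> - Z (e n) \<omega>\<bar> \<partial>M) \<le> 2 * r n" for n
  proof -
    have "(\<integral>\<^sup>+\<omega>. ennreal \<bar>Z 0 \<omega> - Z (e n) \<omega>\<bar> \<partial>M) \<le>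
        (\<integral>\<^sup>+\<omega>. ennreal \<bar>LINT u|N \<omega>. G n u\<bar> + ennreal \<bar>LINT u|\<mu>. G n u\<bar> \<partial>M)"
    proof (rule nn_integral_mono_AE)
      show "AE \<omega> in M. ennreal \<bar>Z 0 \<omega> - Z (e n) \<omega>\<bar> \<le>
          ennreal \<bar>LINT u|N \<omega>. G n u\<bar> + ennreal \<bar>LINT u|\<mu>. G n u\<bar>"
        using AE_integrable_N[OF int0] AE_integrable_N[OF int_e[of n]]
      proof eventually_elim
        case (elim \<omega>)
        have "Z 0 \<omega> - Z (e n) \<omega> = (LINT u|N \<omega>. G n u) - (LINT u|\<mu>. G n u)"
          unfolding Z_def G_def set_lebesgue_integral_def using elim int0 int_e by simp
        then show ?case by (simp flip: ennreal_plus)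
      qed
    qed
    also have "\<dots> = (\<integral>\<^sup>+\<omega>. ennreal \<bar>LINT u|N \<omega>. G n u\<bar> \<partial>M) + ennreal \<bar>LINT u|\<mu>. G n u\<bar>"
      using integrable_integral_N[OF int_G, of n] by (subst nn_integral_add) (auto simp: emeasure_space_1)
    also have "\<dots> \<le> r n + r n"
      using nn_integral_abs_integral_N_le[OF int_G, of n] integral_norm_bound_ennreal[OF int_G, of n]
      unfolding r_def by (intro add_mono) auto
    finally show ?thesis by (simp add: mult_2)
  qed
  define c where "c = (\<integral>\<^sup>+\<omega>. ennreal \<bar>J \<omega> - Z 0 \<omega>\<bar> \<partial>M)"
  have "c \<le> ennreal \<delta>" if \<delta>: "0 < \<delta>" for \<delta>
  proof (rule LIMSEQ_le_const)
    have "(\<lambda>n. ennreal \<delta> + ennreal (1 / \<delta>) * d n + 2 * r n) \<longlonglongrightarrow> ennreal \<delta> + ennreal (1 / \<delta>) * 0 + 2 * 0"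
      by (intro tendsto_add tendsto_mult_ennreal tendsto_const d r) auto
    then show "(\<lambda>n. ennreal \<delta> + ennreal (1 / \<delta>) * d n + 2 * r n) \<longlonglongrightarrow> ennreal \<delta>" by simp
    \<comment> \<open>A Young-type inequality that turns L2 smallness into an L1 bound without
      square roots; \<delta> stays fixed while n grows and is made small only afterwards.\<close>
    have abs_le: "\<bar>a\<bar> \<le> \<delta> + 1 / \<delta> * a\<^sup>2" for a :: real
    proof -
      have "\<bar>a\<bar> * \<delta> \<le> \<delta> * \<delta> + a\<^sup>2"
      proof -
        have "0 \<le> \<bar>a\<bar> * \<delta>" using \<delta> by (intro mult_nonneg_nonneg) auto
        moreover have "2 * \<bar>a\<bar> * \<delta> \<le> a\<^sup>2 + \<delta> * \<delta>"
          using sum_squares_bound[of "\<bar>a\<bar>" \<delta>] by (simp add: power2_eq_square)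
        ultimately show ?thesis by linarith
      qed
      then show ?thesis using \<delta> by (simp add: field_simps power2_eq_square)
    qed
    have "c \<le> ennreal \<delta> + ennreal (1 / \<delta>) * d n + 2 * r n" for n
    proof -
      have "c \<le> (\<integral>\<^sup>+\<omega>. (ennreal \<delta> + ennreal (1 / \<delta>) * ennreal ((J \<omega> - Z (e n) \<omega>)\<^sup>2)) +
          ennreal \<bar>Z 0 \<omega> - Z (e n) \<omega>\<bar> \<partial>M)"
        unfolding c_def
      proof (rule nn_integral_mono)
        fix \<omega>
        have "\<bar>J \<omega> - Z 0 \<omega>\<bar> \<le> \<bar>J \<omega> - Z (e n) \<omega>\<bar> + \<bar>Z 0 \<omega> - Z (e n) \<omega>\<bar>" by simp
        also have "\<dots> \<le> (\<delta> + 1 / \<delta> * (J \<omega> - Z (e n) \<omega>)\<^sup>2) + \<bar>Z 0 \<omega> - Z (e n) \<omega>\<bar>"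
          by (intro add_right_mono abs_le)
        finally show "ennreal \<bar>J \<omega> - Z 0 \<omega>\<bar> \<le> (ennreal \<delta> + ennreal (1 / \<delta>) * ennreal ((J \<omega> - Z (e n) \<omega>)\<^sup>2)) +
          ennreal \<bar>Z 0 \<omega> - Z (e n) \<omega>\<bar>"
          using \<delta> by (simp flip: ennreal_plus ennreal_mult)
      qed
      also have "\<dots> = ennreal \<delta> + ennreal (1 / \<delta>) * d n + (\<integral>\<^sup>+\<omega>. ennreal \<bar>Z 0 \<omega> - Z (e n) \<omega>\<bar> \<partial>M)"
        by (simp add: nn_integral_add nn_integral_cmult d_def emeasure_space_1)
      also have "\<dots> \<le> ennreal \<delta> + ennreal (1 / \<delta>) * d n + 2 * r n"
        by (intro add_left_mono diff)
      finally show ?thesis .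
    qed
    then show "\<exists>N. \<forall>n\<ge>N. c \<le> ennreal \<delta> + ennreal (1 / \<delta>) * d n + 2 * r n" by blast
  qed
  then have "c \<le> 0 + ennreal \<delta>" if "0 < \<delta>" for \<delta>
    using that by simp
  then have "c \<le> 0" by (rule ennreal_le_epsilon)
  then have "c = 0" by simp
  then have "AE \<omega> in M. ennreal \<bar>J \<omega> - Z 0 \<omega>\<bar> = 0"
    unfolding c_def by (subst (asm) nn_integral_0_iff_AE) auto
  then show ?thesis by eventually_elim (simp add: Z_def A_def)
qed

text \<open>The two regions leave out only z = 0, where the integrand vanishes because k is
  positive, and large jumps outside \<open>K\<close> form a null set.\<close>

lemma levy_weak_moment_finite:
  fixes l :: "'a::{real_normed_vector,second_countable_topology} measure"
  assumes l: "levy_measure l" and K: "AE z in l. z \<in> K" and k: "0 < k"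
    and small: "(\<integral>\<^sup>+z\<in>{z. 0 < norm z \<and> norm z \<le> 1}. ennreal (\<bar>blinfun_apply f z\<bar> ^ k) \<partial>l) < \<infinity>"
    and large: "(\<integral>\<^sup>+z\<in>{z \<in> K. 1 < norm z}. ennreal (\<bar>blinfun_apply f z\<bar> ^ k) \<partial>l) < \<infinity>"
  shows "(\<integral>\<^sup>+z. ennreal (\<bar>blinfun_apply f z\<bar> ^ k) \<partial>l) < \<infinity>"
proof -
  have sets: "sets l = sets borel" using l by (simp add: levy_measure_def)
  note [measurable_cong] = sets
  let ?g = "\<lambda>z. ennreal (\<bar>blinfun_apply f z\<bar> ^ k)"
  let ?D = "{z::'a. 0 < norm z \<and> norm z \<le> 1}" and ?E = "{z::'a. 1 < norm z}"
  have "(\<integral>\<^sup>+z. ?g z \<partial>l) = (\<integral>\<^sup>+z. ?g z * indicator ?D z + ?g z * indicator ?E z \<partial>l)"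
    using k by (intro nn_integral_cong) (auto simp: indicator_def zero_power)
  also have "\<dots> = (\<integral>\<^sup>+z\<in>?D. ?g z \<partial>l) + (\<integral>\<^sup>+z\<in>?E. ?g z \<partial>l)"
    by (intro nn_integral_add) measurable
  also have "(\<integral>\<^sup>+z\<in>?E. ?g z \<partial>l) = (\<integral>\<^sup>+z\<in>{z \<in> K. 1 < norm z}. ?g z \<partial>l)"
    using K by (intro nn_integral_cong_AE; eventually_elim) (auto simp: indicator_def)
  finally show ?thesis using small large by simp
qed

theorem proposition2p4:
  fixes K :: "'a::{banach,second_countable_topology} set"
    and q :: nat
    and M :: "'w measure"
    and DI :: "'a set" and I :: "'a \<Rightarrow> 'a"
    and DA :: "nat \<Rightarrow> 'a set" and A :: "nat \<Rightarrow> 'a \<Rightarrow> 'a"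
    and D :: "('a ^ 'p::{finite,linorder}) set"
    and S :: "real \<Rightarrow> ('a ^ 'p::{finite,linorder}) \<Rightarrow>\<^sub>L ('a ^ 'p::{finite,linorder})"
    and E :: "'a \<Rightarrow>\<^sub>L 'a" and C :: "nat \<Rightarrow> 'a \<Rightarrow>\<^sub>L 'a"
    and L :: "real \<Rightarrow> 'w \<Rightarrow> 'a"
    and \<gamma> I\<^sub>l \<gamma>\<^sub>0 :: 'a and l :: "'a measure"
    and x :: "'a ^ 'p::{finite,linorder}"
    and X :: "real \<Rightarrow> 'w \<Rightarrow> ('a ^ 'p::{finite,linorder})" and Y :: "real \<Rightarrow> 'w \<Rightarrow> 'a"
    and g :: "'a \<Rightarrow>\<^sub>L real"
  assumes cone: "proper_convex_cone K"
    and dual_generating: "\<And>f :: 'a \<Rightarrow>\<^sub>L real. \<exists>f1\<in>dual_cone K. \<exists>f2\<in>dual_cone K. f = f1 - f2"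
    and order: "q < CARD('p)"
    \<comment> \<open>operators\<close>
    and I: "densely_defined_operator DI I"
    and A: "\<And>j. j \<in> {1..CARD('p)} \<Longrightarrow> densely_defined_operator (DA j) (A j)"
    and D: "subspace D" "D \<subseteq> carma_max_domain DI DA"
    and semigroup: "generates D (carma_matrix I A) S"
    and S_pos: "\<And>t y. 0 \<le> t \<Longrightarrow> y \<in> cone_power K \<Longrightarrow> S t y \<in> cone_power K"
    and E_pos: "\<And>y. y \<in> K \<Longrightarrow> E y \<in> K"
    \<comment> \<open>driving Levy process\<close>
    and M: "prob_space M"
    and levy: "levy_process M L"
    and L_in_K: "AE \<omega> in M. \<forall>t\<ge>0. L t \<omega> \<in> K"
    and triplet: "pure_jump_triplet M L \<gamma> l"
    and jumps: "poisson_random_measure M (jump_measure L) (jump_intensity l)"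
    and l_in_K: "AE z in l. z \<in> K"
    and centering: "pettis_centering l I\<^sub>l"
    and \<gamma>\<^sub>0: "\<gamma>\<^sub>0 = \<gamma> - I\<^sub>l" "\<gamma>\<^sub>0 \<in> K"
    \<comment> \<open>CARMA process\<close>
    and x: "x \<in> cone_power K"
    and X_rv: "\<And>t. 0 \<le> t \<Longrightarrow> X t \<in> borel_measurable M"
    and X_in_K: "\<And>t. 0 \<le> t \<Longrightarrow> AE \<omega> in M. X t \<omega> \<in> cone_power K"
    and X_weak: "weak_solution M D (carma_matrix I A) (carma_E E) L x X"
    and X_voc: "variation_of_constants M S (carma_E E) \<gamma> (jump_measure L) (jump_intensity l) x X"
    and Y: "\<And>t \<omega>. 0 \<le> t \<Longrightarrow> \<omega> \<in> space M \<Longrightarrow> Y t \<omega> = carma_C q C (X t \<omega>)"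
    and moment1: "\<And>f :: 'a \<Rightarrow>\<^sub>L real. (\<integral>\<^sup>+z\<in>{z \<in> K. 1 < norm z}. ennreal \<bar>f z\<bar> \<partial>l) < \<infinity>"
  shows
    "(\<forall>t\<ge>0.
       integrable M (\<lambda>\<omega>. g (Y t \<omega>)) \<and>
       (\<forall>s\<in>{0..t}. set_integrable l K
          (\<lambda>z. dual_map (carma_E E) (dual_map (S (t - s)) (dual_map (carma_C q C) g)) z)) \<and>
       set_integrable lborel {0..t} (\<lambda>s.
          dual_map (carma_E E) (dual_map (S (t - s)) (dual_map (carma_C q C) g)) \<gamma>\<^sub>0 +
          (LINT z:K|l. dual_map (carma_E E) (dual_map (S (t - s)) (dual_map (carma_C q C) g)) z)) \<and>
       prob_space.expectation M (\<lambda>\<omega>. g (Y t \<omega>)) =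
         dual_map (S t) (dual_map (carma_C q C) g) x +
         (LINT s:{0..t}|lborel.
            dual_map (carma_E E) (dual_map (S (t - s)) (dual_map (carma_C q C) g)) \<gamma>\<^sub>0 +
            (LINT z:K|l. dual_map (carma_E E) (dual_map (S (t - s)) (dual_map (carma_C q C) g)) z)))
     \<and>
     ((\<forall>f :: 'a \<Rightarrow>\<^sub>L real. (\<integral>\<^sup>+z\<in>{z \<in> K. 1 < norm z}. ennreal (\<bar>f z\<bar>\<^sup>2) \<partial>l) < \<infinity>) \<longrightarrow>
      (\<forall>t\<ge>0.
         integrable M (\<lambda>\<omega>. (g (Y t \<omega>))\<^sup>2) \<and>
         (\<forall>s\<in>{0..t}. set_integrable l K
            (\<lambda>z. (dual_map (carma_E E) (dual_map (S (t - s)) (dual_map (carma_C q C) g)) z)\<^sup>2)) \<and>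
         set_integrable lborel {0..t} (\<lambda>s.
            LINT z:K|l. (dual_map (carma_E E) (dual_map (S (t - s)) (dual_map (carma_C q C) g)) z)\<^sup>2) \<and>
         prob_space.variance M (\<lambda>\<omega>. g (Y t \<omega>)) =
           (LINT s:{0..t}|lborel. LINT z:K|l.
              (dual_map (carma_E E) (dual_map (S (t - s)) (dual_map (carma_C q C) g)) z)\<^sup>2)))"
proof -
  interpret prob_space M by (rule M)
  define \<mu> where "\<mu> = jump_intensity l"
  define N where "N = jump_measure L"
  interpret poisson_measure M N \<mu>
    using jumps unfolding \<mu>_def N_def by unfold_locales
  \<comment> \<open>Pulling g back along \<open>carma_C q C\<close> reduces everything to the state
    process tested against this one functional.\<close>
  define h where "h = dual_map (carma_C q C :: ('a ^ 'p::{finite,linorder}) \<Rightarrow>\<^sub>L 'a) g"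
  define f where "f = (\<lambda>t s. dual_map (carma_E E) (dual_map (S (t - s)) h))"
  have f_apply: "f t s z = h (S (t - s) (carma_E E z))" for t s z
    by (simp add: f_def dual_map_def)
  define D0 where "D0 = {z::'a. 0 < norm z \<and> norm z \<le> 1}"
  have levy_l: "levy_measure l" using triplet by (simp add: pure_jump_triplet_def)
  have sets_l: "sets l = sets borel" using levy_l by (simp add: levy_measure_def)
  note [measurable_cong] = sets_l
  have K [measurable]: "K \<in> sets borel"
    using cone by (simp add: proper_convex_cone_def borel_closed)
  have scs: "strongly_continuous_semigroup S"
    using semigroup by (simp add: generates_def)
  have gY: "g (Y t \<omega>) = h (X t \<omega>)" if "0 \<le> t" "\<omega> \<in> space M" for t \<omega>
    using Y[OF that] by (simp add: h_def dual_map_def)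

  \<comment> \<open>Regularity in time of the functionals \<open>f t s\<close>\<close>
  have S_cont: "continuous_on {0..t} (\<lambda>s. S (t - s) y)" for t y
    by (rule continuous_on_compose2[of "{0..}" "\<lambda>s. S s y"])
      (use scs in \<open>auto simp: strongly_continuous_semigroup_def intro!: continuous_intros\<close>)
  have f_cont: "continuous_on {0..t} (\<lambda>s. f t s z)" for t z
    unfolding f_apply by (intro continuous_intros S_cont)
  have f_bound: "\<exists>b. \<forall>s\<in>{0..t}. norm (f t s) \<le> b" for t
  proof -
    obtain B where B: "0 \<le> B" "\<And>s. s \<in> {0..t} \<Longrightarrow> norm (S s) \<le> B"
      using strongly_continuous_semigroup_bounded[OF scs, of t] by auto
    have "norm (f t s) \<le> norm h * B * norm (carma_E E :: 'a \<Rightarrow>\<^sub>L ('a ^ 'p::{finite,linorder}))" if "s \<in> {0..t}" for s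
    proof -
      have "norm (f t s) \<le> norm (h o\<^sub>L S (t - s)) * norm (carma_E E :: 'a \<Rightarrow>\<^sub>L ('a ^ 'p::{finite,linorder}))"
        unfolding f_def dual_map_def by (rule norm_blinfun_compose)
      also have "\<dots> \<le> norm h * norm (S (t - s)) * norm (carma_E E :: 'a \<Rightarrow>\<^sub>L ('a ^ 'p::{finite,linorder}))"
        by (intro mult_right_mono norm_blinfun_compose) simp
      also have "\<dots> \<le> norm h * B * norm (carma_E E :: 'a \<Rightarrow>\<^sub>L ('a ^ 'p::{finite,linorder}))"
        using that by (intro mult_right_mono mult_left_mono B) auto
      finally show ?thesis .
    qed
    then show ?thesis by blast
  qed

  \<comment> \<open>Near 0 the first moment comes from the Pettis centering, since the definition of
    a Levy measure controls only squares there.\<close>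
  have weak1: "(\<integral>\<^sup>+z. ennreal (\<bar>blinfun_apply f z\<bar> ^ 1) \<partial>l) < \<infinity>" for f :: "'a \<Rightarrow>\<^sub>L real"
    using levy_weak_moment_finite[OF levy_l l_in_K, of 1 f] moment1[of f] centering
    by (simp add: pettis_centering_def)
  then have int_l: "integrable l (blinfun_apply f)" for f :: "'a \<Rightarrow>\<^sub>L real"
    by (simp add: integrable_iff_bounded)
  \<comment> \<open>All mass of \<open>l\<close> sits on \<open>K\<close>, so integrals over
    \<open>K\<close> can be exchanged for integrals over the whole space, the form in which Fubini
    is applied.\<close>
  have int_K: "set_integrable l K (\<lambda>z. f z ^ k)" "(LINT z:K|l. f z ^ k) = (LINT z:UNIV|l. f z ^ k)"
    if "integrable l (\<lambda>z. f z ^ k)" for f :: "'a \<Rightarrow>\<^sub>L real" and k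
  proof -
    show "set_integrable l K (\<lambda>z. f z ^ k)"
      unfolding set_integrable_def using that by (intro integrable_mult_indicator) (auto simp: sets_l)
    show "(LINT z:K|l. f z ^ k) = (LINT z:UNIV|l. f z ^ k)"
      unfolding set_lebesgue_integral_def
      by (rule integral_cong_AE) (use l_in_K in \<open>auto elim: eventually_mono\<close>)
  qed

  \<comment> \<open>Integrand of all jumps up to time t, small and large together.\<close>
  define \<psi> where "\<psi> = (\<lambda>t u. indicator ({0<..t} \<times> UNIV) u *\<^sub>R f t (fst u) (snd u))"
  have int_power: "set_integrable \<mu> ({0<..t} \<times> UNIV) (\<lambda>(s, z). f t s z ^ k)"
    if "0 \<le> t" "\<And>f :: 'a \<Rightarrow>\<^sub>L real. (\<integral>\<^sup>+z. ennreal (\<bar>blinfun_apply f z\<bar> ^ k) \<partial>l) < \<infinity>" for t k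
  proof -
    obtain b where "\<And>s. s \<in> {0..t} \<Longrightarrow> norm (f t s) \<le> b" using f_bound[of t] by blast
    with that show ?thesis unfolding \<mu>_def
      by (intro blinfun_family_integrable[OF levy_l _ f_cont]) auto
  qed
  have int_\<psi>: "integrable \<mu> (\<psi> t)" if "0 \<le> t" for t
    using int_power[OF that weak1] by (simp add: set_integrable_def \<psi>_def case_prod_beta)
  have int_\<psi>_part: "set_integrable \<mu> ({0<..t} \<times> Z) (\<lambda>(s, z). f t s z)"
    if "0 \<le> t" "Z \<in> sets borel" for t Z
  proof -
    have "integrable \<mu> (\<lambda>u. indicator ({0<..t} \<times> Z) u *\<^sub>R \<psi> t u)"
      using that int_\<psi>[OF that(1)]
      by (intro integrable_mult_indicator)
        (auto simp: \<mu>_def sets_jump_intensity[OF levy_l])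
    moreover have "indicator ({0<..t} \<times> Z) u *\<^sub>R \<psi> t u = indicator ({0<..t} \<times> Z) u *\<^sub>R (case u of (s, z) \<Rightarrow> f t s z)" for u
      by (auto simp: \<psi>_def indicator_def split: prod.split)
    ultimately show ?thesis unfolding set_integrable_def by (simp only:)
  qed

  have int_time: "set_integrable lborel {0..t} (\<lambda>s. f t s y)" for t y
    by (intro borel_integrable_atLeastAtMost' f_cont)
  \<comment> \<open>The deterministic part that survives once the compensator has reduced the drift
    \<gamma> to \<open>\<gamma>\<^sub>0\<close>.\<close>
  define c where "c t = h (S t x) + (LINT s:{0..t}|lborel. f t s \<gamma>\<^sub>0)" for t

  \<comment> \<open>Almost sure representation by the jump measure\<close>
  have repr: "AE \<omega> in M. g (Y t \<omega>) = c t + (LINT u|N \<omega>. \<psi> t u)" if t: "0 \<le> t" for t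
  proof -
    let ?F = "\<lambda>(s, z). f t s z"
    obtain J1 J2 where
      J1: "pettis_small_jump_integral M N \<mu> t (\<lambda>s z. S (t - s) (carma_E E z)) J1" and
      J2: "pettis_large_jump_integral M N t (\<lambda>s z. S (t - s) (carma_E E z)) J2" and
      X: "AE \<omega> in M. X t \<omega> = S t x + integral {0..t} (\<lambda>s. S (t - s) (carma_E E \<gamma>)) + J1 \<omega> + J2 \<omega>"
      using X_voc t unfolding variation_of_constants_def N_def \<mu>_def by blast
    have "has_compensated_integral M N \<mu> t ?F (\<lambda>\<omega>. h (J1 \<omega>))"
      using J1 unfolding pettis_small_jump_integral_def f_apply by blast
    then have small: "AE \<omega> in M. h (J1 \<omega>) =
        (LINT u:{0<..t} \<times> D0|N \<omega>. ?F u) - (LINT u:{0<..t} \<times> D0|\<mu>. ?F u)"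
      unfolding D0_def using int_\<psi>_part[OF t, of "{z. 0 < norm z \<and> norm z \<le> 1}"]
      by (intro AE_compensated_integral_eq poisson_measure_axioms)
        (auto simp: \<mu>_def sets_jump_intensity[OF levy_l])
    have large: "AE \<omega> in M. h (J2 \<omega>) = (LINT u:{0<..t} \<times> {z. 1 < norm z}|N \<omega>. ?F u)"
      using J2 unfolding pettis_large_jump_integral_def f_apply by blast
    \<comment> \<open>The drift is a gauge integral of a vector function. Continuity on a compact
      interval lets \<open>h\<close> pass inside and makes the resulting scalar integral agree with
      the Lebesgue one.\<close>
    have drift: "h (integral {0..t} (\<lambda>s. S (t - s) (carma_E E \<gamma>))) = (LINT s:{0..t}|lborel. f t s \<gamma>)"
    proof -
      have "integral {0..t} (blinfun_apply h \<circ> (\<lambda>s. S (t - s) (carma_E E \<gamma>))) =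
          h (integral {0..t} (\<lambda>s. S (t - s) (carma_E E \<gamma>)))"
        by (intro integral_linear integrable_continuous_interval S_cont blinfun.bounded_linear_right)
      then show ?thesis
        using set_borel_integral_eq_integral(2)[OF int_time, of t \<gamma>] by (simp add: f_apply comp_def)
    qed
    \<comment> \<open>For fixed s the inner integral is the Pettis identity for the functional
      \<open>f t s\<close>, so integrating out the jumps puts \<open>I\<^sub>l\<close> in place of
      z.\<close>
    have compensator: "(LINT u:{0<..t} \<times> D0|\<mu>. ?F u) = (LINT s:{0..t}|lborel. f t s I\<^sub>l)"
    proof -
      have "(LINT u:{0<..t} \<times> D0|\<mu>. ?F u) = (LINT s:{0..t}|lborel. LINT z:D0|l. f t s z)"
        using jump_intensity_integral_fst[OF levy_l t, of D0 ?F] int_\<psi>_part[OF t, of D0]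
        by (simp add: \<mu>_def D0_def)
      also have "(\<lambda>s. LINT z:D0|l. f t s z) = (\<lambda>s. f t s I\<^sub>l)"
        using centering by (simp add: pettis_centering_def D0_def)
      finally show ?thesis .
    qed
    have "(LINT s:{0..t}|lborel. f t s \<gamma>) = (LINT s:{0..t}|lborel. f t s \<gamma>\<^sub>0 + f t s I\<^sub>l)"
      by (simp add: \<gamma>\<^sub>0(1) blinfun.diff_right)
    then have drift_split: "(LINT s:{0..t}|lborel. f t s \<gamma>) =
        (LINT s:{0..t}|lborel. f t s \<gamma>\<^sub>0) + (LINT s:{0..t}|lborel. f t s I\<^sub>l)"
      using set_integral_add(2)[OF int_time int_time] by simp
    have small_int: "AE \<omega> in M. set_integrable (N \<omega>) ({0<..t} \<times> D0) ?F"
      using AE_integrable_N int_\<psi>_part[OF t, of D0] by (simp add: set_integrable_def D0_def)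
    have large_int: "AE \<omega> in M. set_integrable (N \<omega>) ({0<..t} \<times> {z. 1 < norm z}) ?F"
      using AE_integrable_N int_\<psi>_part[OF t, of "{z. 1 < norm z}"] by (simp add: set_integrable_def)
    \<comment> \<open>Small and large jumps together leave out z = 0, where the linear functional
      vanishes.\<close>
    have split: "\<psi> t u = indicator ({0<..t} \<times> D0) u *\<^sub>R ?F u + indicator ({0<..t} \<times> {z. 1 < norm z}) u *\<^sub>R ?F u" for u
      by (cases "snd u = 0") (auto simp: \<psi>_def D0_def indicator_def split: prod.split)
    show ?thesis
      using X small large small_int large_int AE_space
    proof eventually_elim
      case (elim \<omega>)
      have "(LINT u|N \<omega>. \<psi> t u) =
          (LINT u:{0<..t} \<times> D0|N \<omega>. ?F u) + (LINT u:{0<..t} \<times> {z. 1 < norm z}|N \<omega>. ?F u)"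
        using elim(4,5) unfolding split set_integrable_def set_lebesgue_integral_def
        by (rule Bochner_Integration.integral_add)
      moreover have "g (Y t \<omega>) = h (S t x) + h (integral {0..t} (\<lambda>s. S (t - s) (carma_E E \<gamma>))) + h (J1 \<omega>) + h (J2 \<omega>)"
        using gY[OF t elim(6)] elim(1) by (simp add: blinfun.add_right)
      ultimately show ?case
        using elim(2,3) by (simp add: drift drift_split compensator c_def)
    qed
  qed

  \<comment> \<open>Mean of the tested process\<close>
  have gY_meas [measurable]: "(\<lambda>\<omega>. g (Y t \<omega>)) \<in> borel_measurable M" if t: "0 \<le> t" for t
  proof -
    \<comment> \<open>Measurability is taken from \<open>X\<close>: almost sure equality with a
      measurable function would give it only for complete \<open>M\<close>.\<close>
    have "(\<lambda>\<omega>. h (X t \<omega>)) \<in> borel_measurable M"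
      by (rule measurable_compose[OF X_rv[OF t] blinfun_measurable])
    then show ?thesis using measurable_cong[of M "\<lambda>\<omega>. g (Y t \<omega>)" "\<lambda>\<omega>. h (X t \<omega>)"] gY[OF t] by blast
  qed
  have int_gY: "integrable M (\<lambda>\<omega>. g (Y t \<omega>))"
    and mean_gY: "expectation (\<lambda>\<omega>. g (Y t \<omega>)) = c t + (LINT u|\<mu>. \<psi> t u)" if t: "0 \<le> t" for t
  proof -
    have int: "integrable M (\<lambda>\<omega>. c t + (LINT u|N \<omega>. \<psi> t u))"
      by (intro Bochner_Integration.integrable_add integrable_integral_N int_\<psi> t) simp
    then show "integrable M (\<lambda>\<omega>. g (Y t \<omega>))"
      by (rule integrable_cong_AE_imp) (use repr[OF t] gY_meas[OF t] in \<open>auto elim: eventually_mono\<close>)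
    have "expectation (\<lambda>\<omega>. g (Y t \<omega>)) = expectation (\<lambda>\<omega>. c t + (LINT u|N \<omega>. \<psi> t u))"
      using int gY_meas[OF t] repr[OF t] by (intro integral_cong_AE) auto
    also have "\<dots> = c t + (LINT u|\<mu>. \<psi> t u)"
      using integrable_integral_N[OF int_\<psi>[OF t]] expectation_integral_N[OF int_\<psi>[OF t]]
      by (simp add: prob_space)
    finally show "expectation (\<lambda>\<omega>. g (Y t \<omega>)) = c t + (LINT u|\<mu>. \<psi> t u)" .
  qed
  have fubini: "set_integrable lborel {0..t} (\<lambda>s. LINT z:K|l. f t s z)"
    "(LINT u|\<mu>. \<psi> t u) = (LINT s:{0..t}|lborel. LINT z:K|l. f t s z)" if t: "0 \<le> t" for t
  proof -
    have K: "(LINT z:K|l. f t s z) = (LINT z:UNIV|l. f t s z)" for s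
      using int_K(2)[of "f t s" 1] int_l[of "f t s"] by simp
    show "set_integrable lborel {0..t} (\<lambda>s. LINT z:K|l. f t s z)"
      using jump_intensity_integrable_fst[OF levy_l t, of UNIV "\<lambda>(s, z). f t s z"] int_\<psi>_part[OF t, of UNIV]
      by (simp add: \<mu>_def K)
    have "(LINT u|\<mu>. \<psi> t u) = (LINT u:{0<..t} \<times> UNIV|\<mu>. case u of (s, z) \<Rightarrow> f t s z)"
      by (simp add: \<psi>_def set_lebesgue_integral_def case_prod_beta)
    then show "(LINT u|\<mu>. \<psi> t u) = (LINT s:{0..t}|lborel. LINT z:K|l. f t s z)"
      using jump_intensity_integral_fst[OF levy_l t, of UNIV "\<lambda>(s, z). f t s z"] int_\<psi>_part[OF t, of UNIV]
      by (simp add: \<mu>_def K)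
  qed

  have first: "integrable M (\<lambda>\<omega>. g (Y t \<omega>)) \<and>
       (\<forall>s\<in>{0..t}. set_integrable l K (f t s)) \<and>
       set_integrable lborel {0..t} (\<lambda>s. f t s \<gamma>\<^sub>0 + (LINT z:K|l. f t s z)) \<and>
       expectation (\<lambda>\<omega>. g (Y t \<omega>)) = dual_map (S t) h x +
         (LINT s:{0..t}|lborel. f t s \<gamma>\<^sub>0 + (LINT z:K|l. f t s z))" if t: "0 \<le> t" for t
  proof (intro conjI ballI)
    show "integrable M (\<lambda>\<omega>. g (Y t \<omega>))" by (rule int_gY[OF t])
    show "set_integrable l K (f t s)" for s
      using int_K(1)[of "f t s" 1] int_l[of "f t s"] by simp
    show "set_integrable lborel {0..t} (\<lambda>s. f t s \<gamma>\<^sub>0 + (LINT z:K|l. f t s z))"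
      by (intro set_integral_add int_time fubini t)
    show "expectation (\<lambda>\<omega>. g (Y t \<omega>)) = dual_map (S t) h x +
         (LINT s:{0..t}|lborel. f t s \<gamma>\<^sub>0 + (LINT z:K|l. f t s z))"
      unfolding set_integral_add(2)[OF int_time fubini(1)[OF t]] mean_gY[OF t] fubini(2)[OF t]
      by (simp add: c_def dual_map_def)
  qed

  \<comment> \<open>Second moments and variance\<close>
  have second: "integrable M (\<lambda>\<omega>. (g (Y t \<omega>))\<^sup>2) \<and>
         (\<forall>s\<in>{0..t}. set_integrable l K (\<lambda>z. (f t s z)\<^sup>2)) \<and>
         set_integrable lborel {0..t} (\<lambda>s. LINT z:K|l. (f t s z)\<^sup>2) \<and>
         variance (\<lambda>\<omega>. g (Y t \<omega>)) = (LINT s:{0..t}|lborel. LINT z:K|l. (f t s z)\<^sup>2)"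
    if t: "0 \<le> t" and moment2: "\<And>f :: 'a \<Rightarrow>\<^sub>L real. (\<integral>\<^sup>+z\<in>{z \<in> K. 1 < norm z}. ennreal (\<bar>blinfun_apply f z\<bar>\<^sup>2) \<partial>l) < \<infinity>"
    for t
  proof -
    \<comment> \<open>Near 0 the second moment is part of the definition of a Levy measure;
      \<open>moment2\<close> supplies the large jumps.\<close>
    have weak2: "(\<integral>\<^sup>+z. ennreal (\<bar>blinfun_apply f z\<bar>\<^sup>2) \<partial>l) < \<infinity>" for f :: "'a \<Rightarrow>\<^sub>L real"
      using levy_weak_moment_finite[OF levy_l l_in_K, of 2 f] moment2[of f] levy_l
      by (simp add: levy_measure_def)
    then have int2_l: "integrable l (\<lambda>z. (f z)\<^sup>2)" for f :: "'a \<Rightarrow>\<^sub>L real"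
      by (simp add: integrable_iff_bounded)
    have int_sq: "set_integrable \<mu> ({0<..t} \<times> UNIV) (\<lambda>(s, z). (f t s z)\<^sup>2)"
      by (rule int_power[OF t weak2])
    have \<psi>_sq: "(\<psi> t u)\<^sup>2 = indicator ({0<..t} \<times> UNIV) u *\<^sub>R (case u of (s, z) \<Rightarrow> (f t s z)\<^sup>2)" for u
      by (auto simp: \<psi>_def indicator_def split: prod.split)
    have int2_\<psi>: "integrable \<mu> (\<lambda>u. (\<psi> t u)\<^sup>2)"
      using int_sq by (simp add: set_integrable_def \<psi>_sq)
    have K: "(LINT z:K|l. (f t s z)\<^sup>2) = (LINT z:UNIV|l. (f t s z)\<^sup>2)" for s
      by (intro int_K int2_l)
    note int_W = integrable_integral_N[OF int_\<psi>[OF t]] integrable_integral_N_square[OF int_\<psi>[OF t] int2_\<psi>]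
    have int2: "integrable M (\<lambda>\<omega>. (c t)\<^sup>2 + 2 * c t * (LINT u|N \<omega>. \<psi> t u) + (LINT u|N \<omega>. \<psi> t u)\<^sup>2)"
      using int_W by auto
    have repr2: "AE \<omega> in M. (g (Y t \<omega>))\<^sup>2 =
        (c t)\<^sup>2 + 2 * c t * (LINT u|N \<omega>. \<psi> t u) + (LINT u|N \<omega>. \<psi> t u)\<^sup>2"
      using repr[OF t] by eventually_elim (simp add: power2_sum algebra_simps)
    have gY2 [measurable]: "(\<lambda>\<omega>. (g (Y t \<omega>))\<^sup>2) \<in> borel_measurable M"
      using gY_meas[OF t] by (rule borel_measurable_power)
    have int_gY2: "integrable M (\<lambda>\<omega>. (g (Y t \<omega>))\<^sup>2)"
      using int2 by (rule integrable_cong_AE_imp) (use repr2 gY2 in \<open>auto elim: eventually_mono\<close>)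
    have "expectation (\<lambda>\<omega>. (g (Y t \<omega>))\<^sup>2) =
        expectation (\<lambda>\<omega>. (c t)\<^sup>2 + 2 * c t * (LINT u|N \<omega>. \<psi> t u) + (LINT u|N \<omega>. \<psi> t u)\<^sup>2)"
      using int2 gY2 repr2 by (intro integral_cong_AE) auto
    also have "\<dots> = (c t)\<^sup>2 + 2 * c t * (LINT u|\<mu>. \<psi> t u) + ((LINT u|\<mu>. (\<psi> t u)\<^sup>2) + (LINT u|\<mu>. \<psi> t u)\<^sup>2)"
      using int_W expectation_integral_N[OF int_\<psi>[OF t]] expectation_integral_N_square[OF int_\<psi>[OF t] int2_\<psi>]
      by (simp add: prob_space)
    \<comment> \<open>The constant \<open>c t\<close> drops out, and the second Campbell formula
      exceeds the squared mean by exactly the integral of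
      \<open>(\<psi> t u)\<^sup>2\<close>.\<close>
    finally have "variance (\<lambda>\<omega>. g (Y t \<omega>)) = (LINT u|\<mu>. (\<psi> t u)\<^sup>2)"
      unfolding variance_eq[OF int_gY[OF t] int_gY2] unfolding mean_gY[OF t]
      by (simp add: power2_sum)
    also have "\<dots> = (LINT u:{0<..t} \<times> UNIV|\<mu>. case u of (s, z) \<Rightarrow> (f t s z)\<^sup>2)"
      by (simp only: \<psi>_sq set_lebesgue_integral_def)
    also have "\<dots> = (LINT s:{0..t}|lborel. LINT z:K|l. (f t s z)\<^sup>2)"
      using jump_intensity_integral_fst[OF levy_l t, of UNIV "\<lambda>(s, z). (f t s z)\<^sup>2"] int_sq
      by (simp add: \<mu>_def K)
    finally show ?thesis
      using int_gY2 int_K(1)[OF int2_l] int_sq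
        jump_intensity_integrable_fst[OF levy_l t, of UNIV "\<lambda>(s, z). (f t s z)\<^sup>2"]
      by (simp add: \<mu>_def K)
  qed
  show ?thesis
    using first second unfolding f_def h_def by blast
qed

end
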